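(* Let $H$ be a finite abelian group with $|H|=q$. Then $q \in \mathbb{Z}_M(\mathcal{L})$ if and only if $$ Z_\mathcal{L}(G, H,\mathbf{v}) = q^{\mathrm{rk}(G)} Z_{\mathcal{M}_\mathcal{L}}(q,\mathbf{v}), $$ as a polynomial in $\mathbf{v}$.
   Context: Let $\mathcal{L}=(g_e)_{e \in E}$ be a finite list of elements of a finitely generated abelian group $G$. For $A\subseteq E$, let $\mathcal{L}_A=(g_e)_{e\in A}$, let $\mathrm{rk}(A)$ be the rank of the subgroup $\langle\mathcal{L}_A\rangle$, let $G_A$ be the torsion subgroup of $G/\langle \mathcal{L}_A\rangle$ and $m(A):=|G_A|$; $\mathcal{M}_\mathcal{L}$ is the matroid on $E$ with rank function $\mathrm{rk}$. Its multivariate Tutte polynomial is $Z_{\mathcal{M}_\mathcal{L}}(q,\mathbf{v}) = \sum_{A \subseteq E} q^{-\mathrm{rk}(A)} \prod_{e \in A}v_e$. For a finite abelian group $H$, define $Z_\mathcal{L}(G, H,\mathbf{v}) := \sum_{\phi \in \mathrm{Hom}(G, H)} \prod_{e \in E}(1+v_{e}\delta(\phi(g_e),0))$, with $\delta$ the Kronecker delta. Let $\mathbb{Z}_M(\mathcal{L}) := \{q \in \mathbb{Z}_{>0} : \gcd(q, N)=1\}$, where $N$ is the least common multiple of the multiplicities $m(B)$ over all bases $B \subseteq E$ of $\mathcal{M}_\mathcal{L}$. *)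

theory Defs
  imports Complex_Main "HOL-Algebra.Algebra" "HOL-Library.Poly_Mapping"
begin

text \<open>Abelian groups are written multiplicatively, as in HOL-Algebra: the neutral element
  \<open>\<one>\<close> plays the role of \<open>0\<close>. A list of group elements is a family \<open>g\<close>
  indexed by a finite set \<open>E\<close>; repetitions are allowed.\<close>

definition fin_generated :: "('a, 'b) monoid_scheme \<Rightarrow> bool" where
  "fin_generated G \<longleftrightarrow> (\<exists>S. finite S \<and> S \<subseteq> carrier G \<and> generate G S = carrier G)"

definition int_independent :: "('a, 'b) monoid_scheme \<Rightarrow> 'a set \<Rightarrow> bool" where
  "int_independent G S \<longleftrightarrow> finite S \<and> S \<subseteq> carrier G \<and>
     (\<forall>c :: 'a \<Rightarrow> int.
        (\<Otimes>\<^bsub>G\<^esub>x\<in>S. x [^]\<^bsub>G\<^esub> c x) = \<one>\<^bsub>G\<^esub> \<longrightarrow> (\<forall>x\<in>S. c x = 0))"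

text \<open>The torsion-free rank. The maximum is meaningful for finitely generated abelian groups,
  where the sizes of independent sets are bounded.\<close>

definition ab_rank :: "('a, 'b) monoid_scheme \<Rightarrow> nat" where
  "ab_rank G = Max (card ` {S. int_independent G S})"

definition torsion_part :: "('a, 'b) monoid_scheme \<Rightarrow> 'a set" where
  "torsion_part G = {x \<in> carrier G. \<exists>n::nat. n > 0 \<and> x [^]\<^bsub>G\<^esub> n = \<one>\<^bsub>G\<^esub>}"

definition list_rank :: "('a, 'b) monoid_scheme \<Rightarrow> ('e \<Rightarrow> 'a) \<Rightarrow> 'e set \<Rightarrow> nat" where
  "list_rank G g A = ab_rank (subgroup_generated G (g ` A))"

definition multiplicity_fun :: "('a, 'b) monoid_scheme \<Rightarrow> ('e \<Rightarrow> 'a) \<Rightarrow> 'e set \<Rightarrow> nat" where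
  "multiplicity_fun G g A = card (torsion_part (G Mod (generate G (g ` A))))"

text \<open>A matroid is given by its ground set \<open>E\<close> and its rank function \<open>r\<close>.\<close>

definition matroid_indep :: "'e set \<Rightarrow> ('e set \<Rightarrow> nat) \<Rightarrow> 'e set set" where
  "matroid_indep E r = {A. A \<subseteq> E \<and> r A = card A}"

definition matroid_bases :: "'e set \<Rightarrow> ('e set \<Rightarrow> nat) \<Rightarrow> 'e set set" where
  "matroid_bases E r =
     {B \<in> matroid_indep E r. \<forall>A\<in>matroid_indep E r. B \<subseteq> A \<longrightarrow> A = B}"

text \<open>Formal polynomials over \<open>\<rat>\<close> in the indeterminates \<open>v\<^sub>e\<close>: finitely supported
  coefficient functions on monomials, a monomial being a finitely supported exponent function.\<close>

type_synonym 'e mvpoly = "('e \<Rightarrow>\<^sub>0 nat) \<Rightarrow>\<^sub>0 rat"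

definition pvar :: "'e \<Rightarrow> 'e mvpoly" where
  "pvar e = Poly_Mapping.single (Poly_Mapping.single e 1) 1"

definition pconst :: "rat \<Rightarrow> 'e mvpoly" where
  "pconst c = Poly_Mapping.single 0 c"

definition multivariate_tutte :: "'e set \<Rightarrow> ('e set \<Rightarrow> nat) \<Rightarrow> nat \<Rightarrow> 'e mvpoly" where
  "multivariate_tutte E r q =
     (\<Sum>A\<in>Pow E. pconst (of_nat q powi (- int (r A))) * (\<Prod>e\<in>A. pvar e))"

text \<open>\<^const>\<open>hom\<close> does not restrict values outside the carrier, so homomorphisms are
  normalised by extensionality in order to count each of them once.\<close>

definition Hom_set ::
  "('a, 'b) monoid_scheme \<Rightarrow> ('c, 'd) monoid_scheme \<Rightarrow> ('a \<Rightarrow> 'c) set" where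
  "Hom_set G H = hom G H \<inter> extensional (carrier G)"

definition hom_partition_function ::
  "('a, 'b) monoid_scheme \<Rightarrow> ('c, 'd) monoid_scheme \<Rightarrow> 'e set \<Rightarrow> ('e \<Rightarrow> 'a) \<Rightarrow> 'e mvpoly" where
  "hom_partition_function G H E g =
     (\<Sum>\<phi>\<in>Hom_set G H. \<Prod>e\<in>E. 1 + pvar e * (if \<phi> (g e) = \<one>\<^bsub>H\<^esub> then 1 else 0))"

definition Z_M :: "('a, 'b) monoid_scheme \<Rightarrow> 'e set \<Rightarrow> ('e \<Rightarrow> 'a) \<Rightarrow> nat set" where
  "Z_M G E g =
     {q. q > 0 \<and> gcd q (Lcm (multiplicity_fun G g ` matroid_bases E (list_rank G g))) = 1}"

end

theory Submission
  imports Defs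
begin

text \<open>
  Expanding the product over \<open>E\<close>, the coefficient of \<open>\<Prod>e\<in>A. v\<^sub>e\<close> on the left is the number
  of homomorphisms from \<open>G / \<langle>g\<^sub>A\<rangle>\<close> to \<open>H\<close>, and on the right it is \<open>q\<close> to the rank of
  \<open>G / \<langle>g\<^sub>A\<rangle>\<close>, since ranks are additive. A decomposition of this quotient into cyclic groups shows that
  the two numbers agree iff \<open>q\<close> is coprime to \<open>m(A)\<close>, that is, iff the quotient has no
  \<open>p\<close>-torsion for the primes \<open>p\<close> dividing \<open>q\<close>. It remains to pass from bases to all subsets
  \<open>A\<close> of \<open>E\<close>. Extend a maximal independent subset \<open>B'\<close> of \<open>A\<close> to a basis \<open>B\<close>. If \<open>p u\<close> lies in
  \<open>\<langle>g\<^sub>A\<rangle>\<close>, then \<open>p\<^sup>j k u\<close> lies in \<open>\<langle>g\<^sub>B\<^sub>'\<rangle>\<close> for some \<open>k\<close> prime to \<open>p\<close>; absence of \<open>p\<close>-torsion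
  modulo \<open>\<langle>g\<^sub>B\<rangle>\<close> puts \<open>k u\<close> into \<open>\<langle>g\<^sub>B\<rangle>\<close>, independence of \<open>B\<close> puts it into \<open>\<langle>g\<^sub>B\<^sub>'\<rangle>\<close>, and
  coprimality of \<open>k\<close> and \<open>p\<close> puts \<open>u\<close> into \<open>\<langle>g\<^sub>A\<rangle>\<close>.
\<close>

section \<open>Integer combinations and independence\<close>

definition int_comb :: "('a, 'b) monoid_scheme \<Rightarrow> ('i \<Rightarrow> 'a) \<Rightarrow> 'i set \<Rightarrow> ('i \<Rightarrow> int) \<Rightarrow> 'a" where
  "int_comb G x I c = finprod G (\<lambda>i. x i [^]\<^bsub>G\<^esub> c i) I"

text \<open>The pure closure of the subgroup generated by \<open>S\<close>, that is, the preimage of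
  the torsion part of the quotient. It plays the role of a rational span.\<close>

definition isolator :: "('a, 'b) monoid_scheme \<Rightarrow> 'a set \<Rightarrow> 'a set" where
  "isolator G S = {y \<in> carrier G. \<exists>n::int. n \<noteq> 0 \<and> y [^]\<^bsub>G\<^esub> n \<in> generate G S}"

text \<open>Indexing by \<open>I\<close> makes a repeated element a dependence, as the matroid on
  \<open>E\<close> demands; a bare set of elements could not record this.\<close>

definition fam_independent :: "('a, 'b) monoid_scheme \<Rightarrow> ('i \<Rightarrow> 'a) \<Rightarrow> 'i set \<Rightarrow> bool" where
  "fam_independent G x I \<longleftrightarrow> finite I \<and> x \<in> I \<rightarrow> carrier G \<and>
     (\<forall>c. int_comb G x I c = \<one>\<^bsub>G\<^esub> \<longrightarrow> (\<forall>i\<in>I. c i = 0))"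

section \<open>Arithmetic of integer combinations\<close>

context comm_group
begin

lemma int_comb_closed [simp]:
  "x \<in> I \<rightarrow> carrier G \<Longrightarrow> int_comb G x I c \<in> carrier G"
  unfolding int_comb_def by (rule finprod_closed) auto

lemma int_comb_cong:
  assumes "x \<in> I \<rightarrow> carrier G" "\<And>i. i \<in> I \<Longrightarrow> x i = y i" "\<And>i. i \<in> I \<Longrightarrow> c i = d i"
  shows "int_comb G x I c = int_comb G y I d"
proof -
  have "y i \<in> carrier G" if "i \<in> I" for i
    using assms(1,2) that by (metis PiE)
  then show ?thesis
    unfolding int_comb_def using assms by (intro finprod_cong') auto
qed

lemma int_comb_empty [simp]: "int_comb G x {} c = \<one>"
  by (simp add: int_comb_def)

lemma int_comb_insert:
  assumes "finite I" "j \<notin> I" "x \<in> insert j I \<rightarrow> carrier G"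
  shows "int_comb G x (insert j I) c = x j [^] c j \<otimes> int_comb G x I c"
  unfolding int_comb_def using assms by (subst finprod_insert) auto

lemma int_comb_add:
  assumes "x \<in> I \<rightarrow> carrier G"
  shows "int_comb G x I (\<lambda>i. c i + d i) = int_comb G x I c \<otimes> int_comb G x I d"
proof -
  have "int_comb G x I (\<lambda>i. c i + d i) = finprod G (\<lambda>i. x i [^] c i \<otimes> x i [^] d i) I"
    unfolding int_comb_def using assms by (intro finprod_cong') (auto simp: int_pow_mult Pi_iff)
  also have "\<dots> = int_comb G x I c \<otimes> int_comb G x I d"
    unfolding int_comb_def using assms by (intro finprod_multf) auto
  finally show ?thesis .
qed

lemma int_comb_zero:
  assumes "\<And>i. i \<in> I \<Longrightarrow> c i = 0"
  shows "int_comb G x I c = \<one>"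
  unfolding int_comb_def using assms by (intro finprod_one_eqI) auto

lemma int_comb_subset:
  assumes "finite I" "x \<in> I \<rightarrow> carrier G" "J \<subseteq> I" "\<And>i. i \<in> I - J \<Longrightarrow> c i = 0"
  shows "int_comb G x I c = int_comb G x J c"
  unfolding int_comb_def
proof (rule finprod_mono_neutral_cong_right)
  show "(\<lambda>i. x i [^] c i) \<in> I \<rightarrow> carrier G" using assms(2) by auto
  show "x i [^] c i = \<one>" if "i \<in> I - J" for i using assms(4)[OF that] by simp
qed (use assms in auto)

lemma int_comb_scale:
  assumes "finite I" "x \<in> I \<rightarrow> carrier G"
  shows "int_comb G x I (\<lambda>i. c i * k) = int_comb G x I c [^] k"
  using assms
proof (induction I rule: finite_induct)
  case (insert j I)
  then have x: "x \<in> I \<rightarrow> carrier G" "x j \<in> carrier G" by auto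
  have "int_comb G x (insert j I) (\<lambda>i. c i * k) = x j [^] (c j * k) \<otimes> int_comb G x I (\<lambda>i. c i * k)"
    using insert by (subst int_comb_insert) auto
  also have "\<dots> = (x j [^] c j) [^] k \<otimes> int_comb G x I c [^] k"
    using insert x by (simp add: int_pow_pow)
  also have "\<dots> = (x j [^] c j \<otimes> int_comb G x I c) [^] k"
    using x by (subst int_pow_distrib) auto
  also have "x j [^] c j \<otimes> int_comb G x I c = int_comb G x (insert j I) c"
    using insert by (subst int_comb_insert) auto
  finally show ?case .
qed simp

lemma int_comb_uminus:
  assumes "finite I" "x \<in> I \<rightarrow> carrier G"
  shows "int_comb G x I (\<lambda>i. - c i) = inv (int_comb G x I c)"
  using int_comb_scale[OF assms, of c "-1"] assms by (simp add: int_pow_neg)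

lemma int_comb_diff_eq_one_iff:
  assumes "finite I" "x \<in> I \<rightarrow> carrier G"
  shows "int_comb G x I (\<lambda>i. c i - d i) = \<one> \<longleftrightarrow> int_comb G x I c = int_comb G x I d"
proof -
  have "int_comb G x I (\<lambda>i. c i - d i) = int_comb G x I c \<otimes> inv (int_comb G x I d)"
    using int_comb_add[OF assms(2), of c "\<lambda>i. - d i"] int_comb_uminus[OF assms, of d] by simp
  moreover have "a \<otimes> inv b = \<one> \<longleftrightarrow> a = b" if "a \<in> carrier G" "b \<in> carrier G" for a b
    using that inv_equality[of a "inv b"] by auto
  ultimately show ?thesis using assms by simp
qed

lemma int_comb_single:
  assumes "finite I" "x \<in> I \<rightarrow> carrier G" "j \<in> I"
  shows "int_comb G x I (\<lambda>i. if i = j then k else 0) = x j [^] k"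
proof -
  obtain J where J: "I = insert j J" "j \<notin> J" "finite J"
    using assms by (metis mk_disjoint_insert finite_insert)
  have "int_comb G x J (\<lambda>i. if i = j then k else 0) = \<one>"
    using J by (intro int_comb_zero) auto
  then show ?thesis using J assms by (simp add: int_comb_insert)
qed

text \<open>Substituting one family into another multiplies the coefficient vector by the matrix
  \<open>a\<close>, which reduces exchange arguments to linear systems.\<close>

lemma int_comb_int_comb:
  assumes "finite I" "finite J" "x \<in> J \<rightarrow> carrier G"
    and "\<And>i. i \<in> I \<Longrightarrow> y i = int_comb G x J (a i)"
  shows "int_comb G y I c = int_comb G x J (\<lambda>j. \<Sum>i\<in>I. c i * a i j)"
  using assms
proof (induction I rule: finite_induct)
  case empty
  then show ?case by (simp add: int_comb_zero)
next
  case (insert k I)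
  have y: "y \<in> insert k I \<rightarrow> carrier G" using insert by auto
  have "int_comb G y (insert k I) c = y k [^] c k \<otimes> int_comb G y I c"
    using insert y by (subst int_comb_insert) auto
  also have "y k [^] c k = int_comb G x J (\<lambda>j. a k j * c k)"
    using insert by (simp add: int_comb_scale)
  also have "int_comb G y I c = int_comb G x J (\<lambda>j. \<Sum>i\<in>I. c i * a i j)"
    using insert by auto
  finally show ?case
    using insert by (simp add: int_comb_add[symmetric] mult.commute)
qed

text \<open>Unit vectors give the generators, and adding coefficient vectors gives products.
  Membership in a generated subgroup thus becomes a question about coefficients.\<close>

lemma generate_eq_int_comb:
  assumes "finite I" "x \<in> I \<rightarrow> carrier G"
  shows "generate G (x ` I) = range (int_comb G x I)"
proof (intro subset_antisym subsetI)
  fix y assume "y \<in> generate G (x ` I)"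
  then show "y \<in> range (int_comb G x I)"
  proof (induction rule: generate.induct)
    case one
    have "\<one> = int_comb G x I (\<lambda>_. 0)" by (simp add: int_comb_zero)
    then show ?case by blast
  next
    case (incl h)
    then obtain j where j: "j \<in> I" "h = x j" by auto
    have "h = int_comb G x I (\<lambda>i. if i = j then 1 else 0)"
      using int_comb_single[OF assms j(1), of 1] j assms by (auto simp: Pi_iff)
    then show ?case by blast
  next
    case (inv h)
    then obtain j where j: "j \<in> I" "h = x j" by auto
    have "inv h = int_comb G x I (\<lambda>i. if i = j then -1 else 0)"
      using int_comb_single[OF assms j(1), of "-1"] j assms by (auto simp: Pi_iff int_pow_neg)
    then show ?case by blast
  next
    case (eng h1 h2)
    then obtain c d where "h1 = int_comb G x I c" "h2 = int_comb G x I d" by auto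
    then have "h1 \<otimes> h2 = int_comb G x I (\<lambda>i. c i + d i)" using assms by (simp add: int_comb_add)
    then show ?case by blast
  qed
next
  have *: "int_comb G x J c \<in> generate G (x ` I)" if "J \<subseteq> I" for c J
    using finite_subset[OF that assms(1)] that
  proof (induction J rule: finite_induct)
    case empty
    then show ?case by (simp add: generate.one)
  next
    case (insert j J)
    have "x j [^] c j \<in> generate G (x ` I)"
      using insert assms by (intro subgroup_int_pow_closed generate_is_subgroup) (auto intro: generate.incl)
    then show ?case using insert assms
      by (subst int_comb_insert) (auto intro: generate.eng)
  qed
  fix y assume "y \<in> range (int_comb G x I)"
  then show "y \<in> generate G (x ` I)" using * by auto
qed

end

lemma int_comb_hom:
  assumes "comm_group G" "comm_group H" "h \<in> hom G H" "finite I" "x \<in> I \<rightarrow> carrier G"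
  shows "h (int_comb G x I c) = int_comb H (\<lambda>i. h (x i)) I c"
  using assms(4,5)
proof (induction I rule: finite_induct)
  case empty
  interpret G: comm_group G by fact
  interpret H: comm_group H by fact
  show ?case using assms(3) by (simp add: hom_one G.is_group H.is_group)
next
  case (insert j I)
  interpret G: comm_group G by fact
  interpret H: comm_group H by fact
  have "h (int_comb G x (insert j I) c) = h (x j [^]\<^bsub>G\<^esub> c j) \<otimes>\<^bsub>H\<^esub> h (int_comb G x I c)"
    using insert by (subst G.int_comb_insert) (auto simp: hom_mult[OF assms(3)])
  also have "h (x j [^]\<^bsub>G\<^esub> c j) = h (x j) [^]\<^bsub>H\<^esub> c j"
    using insert assms(3) by (intro hom_int_pow) (auto simp: G.is_group H.is_group)
  finally show ?case
    using insert hom_in_carrier[OF assms(3)] by (subst H.int_comb_insert) auto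
qed

text \<open>Fraction-free Gaussian elimination, one equation at a time: a pivot \<open>s0\<close>
  with nonzero entry in equation \<open>t\<close> is eliminated by cross multiplication, which keeps
  all entries integral.\<close>

lemma int_linear_system_nontrivial:
  fixes a :: "'s \<Rightarrow> 't \<Rightarrow> int"
  assumes "finite T" "finite S" "card T < card S"
  shows "\<exists>c. (\<exists>s\<in>S. c s \<noteq> 0) \<and> (\<forall>t\<in>T. (\<Sum>s\<in>S. c s * a s t) = 0)"
  using assms
proof (induction T arbitrary: S a rule: finite_induct)
  case empty
  then have "S \<noteq> {}" by auto
  then show ?case by (intro exI[of _ "\<lambda>_. 1"]) auto
next
  case (insert t T)
  show ?case
  proof (cases "\<forall>s\<in>S. a s t = 0")
    case True
    with insert.IH[of S a] insert show ?thesis by auto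
  next
    case False
    then obtain s0 where s0: "s0 \<in> S" "a s0 t \<noteq> 0" by blast
    define S' where "S' = S - {s0}"
    have S': "finite S'" "card T < card S'" "S = insert s0 S'" "s0 \<notin> S'"
      using insert s0 by (auto simp: S'_def)
    obtain c where c: "\<exists>s\<in>S'. c s \<noteq> 0"
      "\<And>t'. t' \<in> T \<Longrightarrow> (\<Sum>s\<in>S'. c s * (a s0 t * a s t' - a s t * a s0 t')) = 0"
      using insert.IH[of S' "\<lambda>s t'. a s0 t * a s t' - a s t * a s0 t'"] S' by blast
    \<comment> \<open>The solution of the reduced system is scaled by the pivot, and the value at
      \<open>s0\<close> is the one that makes equation \<open>t\<close> hold without
      division.\<close>
    define c' where "c' s = (if s = s0 then - (\<Sum>s\<in>S'. c s * a s t) else c s * a s0 t)" for s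
    have sum: "(\<Sum>s\<in>S. c' s * a s t') =
        (\<Sum>s\<in>S'. c s * (a s0 t * a s t' - a s t * a s0 t'))" for t'
    proof -
      have "(\<Sum>s\<in>S. c' s * a s t') = c' s0 * a s0 t' + (\<Sum>s\<in>S'. c' s * a s t')"
        using S' by simp
      also have "(\<Sum>s\<in>S'. c' s * a s t') = (\<Sum>s\<in>S'. c s * a s0 t * a s t')"
        using S' by (intro sum.cong) (auto simp: c'_def)
      also have "c' s0 * a s0 t' = - (\<Sum>s\<in>S'. c s * a s t * a s0 t')"
        by (simp add: c'_def sum_distrib_right)
      finally show ?thesis
        by (simp add: right_diff_distrib sum_subtractf mult.assoc)
    qed
    have "\<exists>s\<in>S. c' s \<noteq> 0" using c(1) s0 S' by (auto simp: c'_def)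
    moreover have "\<forall>t'\<in>insert t T. (\<Sum>s\<in>S. c' s * a s t') = 0"
      using c(2) by (auto simp: sum algebra_simps)
    ultimately show ?thesis by blast
  qed
qed

section \<open>Cyclic decomposition and well-definedness of the rank\<close>

context comm_group
begin

lemma generate_image_subset:
  assumes "x \<in> I \<rightarrow> carrier G" "\<And>i. i \<in> J \<Longrightarrow> y i \<in> generate G (x ` I)"
  shows "generate G (y ` J) \<subseteq> generate G (x ` I)"
proof (rule generate_subgroup_incl)
  show "y ` J \<subseteq> generate G (x ` I)" using assms(2) by blast
  show "subgroup (generate G (x ` I)) G" using assms(1) by (intro generate_is_subgroup) auto
qed

text \<open>Among all generating families indexed by \<open>I\<close> and all their nontrivial relations, take one in
  which a coefficient attains the least positive value \<open>m\<close>. By minimality \<open>m\<close> divides the other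
  coefficients, so a change of generators turns the relation into \<open>m z = 0\<close>; again by minimality
  \<open>z\<close> spans a direct summand, and induction applies to the remaining generators.\<close>

lemma cyclic_decomposition:
  assumes "finite I" "x \<in> I \<rightarrow> carrier G"
  shows "\<exists>y d. y \<in> I \<rightarrow> carrier G \<and> generate G (y ` I) = generate G (x ` I) \<and>
    (\<forall>c. int_comb G y I c = \<one> \<longleftrightarrow> (\<forall>i\<in>I. int (d i) dvd c i))"
  using assms
proof (induction I arbitrary: x rule: finite_psubset_induct)
  case (psubset I)
  define P where "P m \<longleftrightarrow> m > 0 \<and> (\<exists>y c j. y \<in> I \<rightarrow> carrier G \<and>
    generate G (y ` I) = generate G (x ` I) \<and> int_comb G y I c = \<one> \<and> j \<in> I \<and> c j = int m)" for m :: nat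
  show ?case
  proof (cases "\<exists>m. P m")
    case False
    \<comment> \<open>If no relation has a positive coefficient, negating relations excludes
      negative ones too, so \<open>x\<close> is already free.\<close>
    have "\<forall>i\<in>I. c i = 0" if c: "int_comb G x I c = \<one>" for c
    proof (rule ccontr)
      assume "\<not> (\<forall>i\<in>I. c i = 0)"
      then obtain i where i: "i \<in> I" "c i \<noteq> 0" by blast
      have c': "int_comb G x I (\<lambda>i. - c i) = \<one>"
        using psubset c by (subst int_comb_uminus) auto
      have "P (nat \<bar>c i\<bar>)"
      proof (cases "c i > 0")
        case True
        then show ?thesis unfolding P_def using psubset i c by auto
      next
        case False
        then show ?thesis unfolding P_def using psubset i c'
          by (auto intro!: exI[of _ x] exI[of _ "\<lambda>i. - c i"] exI[of _ i])
      qed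
      with False show False by blast
    qed
    \<comment> \<open>Every \<open>d i\<close> is \<open>0\<close>: only \<open>0\<close> is
      divisible by \<open>0\<close>, so the criterion says that all relations are trivial.\<close>
    then show ?thesis using psubset
      by (intro exI[of _ x] exI[of _ "\<lambda>_. 0"]) (auto simp: int_comb_zero)
  next
    case True
    define m where "m = (LEAST m. P m)"
    have "P m" unfolding m_def using True by (rule LeastI_ex)
    then obtain y c j where m: "m > 0" and y: "y \<in> I \<rightarrow> carrier G"
      and gen_y: "generate G (y ` I) = generate G (x ` I)"
      and c: "int_comb G y I c = \<one>" and j: "j \<in> I" "c j = int m"
      unfolding P_def by blast
    define J where "J = I - {j}"
    have J: "I = insert j J" "j \<notin> J" "finite J" using j psubset by (auto simp: J_def)
    have yJ: "y \<in> J \<rightarrow> carrier G" using y J by auto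
    \<comment> \<open>Division with remainder by \<open>m\<close>. As \<open>q j = 1\<close>, the
      combination \<open>z\<close> with coefficients \<open>q\<close> can replace \<open>y j\<close>
      as a generator.\<close>
    define q where "q i = c i div int m" for i
    define r where "r i = c i mod int m" for i
    have qj: "q j = 1" and rj: "r j = 0" using j m by (auto simp: q_def r_def)
    define z where "z = int_comb G y I q"
    have z: "z \<in> carrier G" using y by (simp add: z_def)
    define y' where "y' = y(j := z)"
    have y': "y' \<in> I \<rightarrow> carrier G" using y z by (auto simp: y'_def)
    have y'_insert: "int_comb G y' I e = z [^] e j \<otimes> int_comb G y J e" for e
    proof -
      have "int_comb G y' J e = int_comb G y J e"
        using yJ J y' by (intro int_comb_cong) (auto simp: y'_def)
      then show ?thesis using J y' by (simp add: int_comb_insert) (simp add: y'_def)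
    qed
    have z_eq: "z = y j \<otimes> int_comb G y J q"
      using J y qj unfolding z_def by (auto simp: int_comb_insert)
    have "y j = int_comb G y' I (\<lambda>i. if i = j then 1 else - q i)"
    proof -
      have "int_comb G y J (\<lambda>i. if i = j then 1 else - q i) = int_comb G y J (\<lambda>i. - q i)"
        using J yJ by (intro int_comb_cong) auto
      also have "\<dots> = inv (int_comb G y J q)" using J yJ by (simp add: int_comb_uminus)
      finally have "int_comb G y' I (\<lambda>i. if i = j then 1 else - q i) = z \<otimes> inv (int_comb G y J q)"
        using z by (simp add: y'_insert)
      also have "\<dots> = y j" unfolding z_eq using y j yJ by (simp add: m_assoc Pi_iff)
      finally show ?thesis by simp
    qed
    then have yj_gen: "y j \<in> generate G (y' ` I)"
      using y' psubset by (simp add: generate_eq_int_comb)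
    have gen_y': "generate G (y' ` I) = generate G (x ` I)"
    proof -
      have "z \<in> generate G (y ` I)" unfolding z_def using y psubset by (simp add: generate_eq_int_comb)
      then have "generate G (y' ` I) \<subseteq> generate G (y ` I)"
        using y by (intro generate_image_subset) (auto simp: y'_def intro: generate.incl)
      moreover have "generate G (y ` I) \<subseteq> generate G (y' ` I)"
      proof (intro generate_image_subset y')
        fix i assume "i \<in> I"
        then show "y i \<in> generate G (y' ` I)" using yj_gen
          by (cases "i = j") (auto intro!: generate.incl simp: y'_def image_iff)
      qed
      ultimately show ?thesis using gen_y by blast
    qed
    \<comment> \<open>Otherwise \<open>e i\<close> would be a positive coefficient below the minimum
      \<open>m\<close>, in a relation of a family that generates the same subgroup.\<close>
    have small: "e i = 0" if "int_comb G y' I e = \<one>" "i \<in> I" "0 \<le> e i" "e i < int m" for e i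
    proof (rule ccontr)
      assume "e i \<noteq> 0"
      then have "P (nat (e i))" unfolding P_def using that y' gen_y' by auto
      then have "m \<le> nat (e i)" unfolding m_def by (rule Least_le)
      with that show False by linarith
    qed
    \<comment> \<open>In additive notation the chosen relation reads \<open>m z\<close> plus the
      terms \<open>r i y i\<close> over \<open>J\<close>. This is a relation of \<open>y'\<close>
      whose coefficients on \<open>J\<close> lie below \<open>m\<close>, so minimality makes them
      vanish.\<close>
    have zm: "z [^] int m = \<one>"
    proof -
      have "int_comb G y J r = int_comb G y I r"
        using J y yJ rj by (simp add: int_comb_insert Pi_iff)
      then have *: "z [^] int m \<otimes> int_comb G y J r = int_comb G y I (\<lambda>i. q i * int m + r i)"
        using y yJ psubset by (simp add: z_def int_comb_add int_comb_scale)
      also have "\<dots> = \<one>" using c by (simp add: q_def r_def)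
      finally have rel: "z [^] int m \<otimes> int_comb G y J r = \<one>" .
      define e where "e = r(j := int m)"
      have "int_comb G y J e = int_comb G y J r"
        using J yJ by (intro int_comb_cong) (auto simp: e_def)
      then have "int_comb G y' I e = \<one>" using rel by (simp add: y'_insert) (simp add: e_def)
      moreover have "e i = r i" "0 \<le> r i" "r i < int m" if "i \<in> J" for i
        using that J m by (auto simp: e_def r_def)
      ultimately have "r i = 0" if "i \<in> J" for i
        using small[of e i] that J by auto
      then have "int_comb G y J r = \<one>" by (intro int_comb_zero) auto
      then show ?thesis using rel z by simp
    qed
    have z_pow: "z [^] k = \<one>" if dvd: "int m dvd k" for k
    proof -
      obtain l where "k = int m * l" using dvd by (auto elim: dvdE)
      then show ?thesis using zm z int_pow_pow[of z "int m" l] by simp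
    qed
    \<comment> \<open>Since \<open>m z = 0\<close>, the coefficient at \<open>j\<close> may be
      reduced modulo \<open>m\<close>, and the remainder vanishes by minimality. Hence
      \<open>z\<close> spans a direct summand of order \<open>m\<close>.\<close>
    have m_dvd: "int m dvd e j" if e: "int_comb G y' I e = \<one>" for e
    proof -
      have "z [^] e j = z [^] (e j mod int m + int m * (e j div int m))" by simp
      also have "\<dots> = z [^] (e j mod int m)" using z by (subst int_pow_mult) (auto simp: z_pow)
      finally have "z [^] e j = z [^] (e j mod int m)" .
      moreover have "int_comb G y J (e(j := e j mod int m)) = int_comb G y J e"
        using J yJ by (intro int_comb_cong) auto
      ultimately have "int_comb G y' I (e(j := e j mod int m)) = int_comb G y' I e"
        by (simp add: y'_insert)
      then have "e j mod int m = 0" using small[of "e(j := e j mod int m)" j] e j m by simp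
      then show ?thesis by blast
    qed
    have "J \<subset> I" using J by auto
    then obtain w d where w: "w \<in> J \<rightarrow> carrier G" "generate G (w ` J) = generate G (y ` J)"
      and d: "\<And>c. int_comb G w J c = \<one> \<longleftrightarrow> (\<forall>i\<in>J. int (d i) dvd c i)"
      using psubset.IH[of J y] yJ by metis
    define w' where "w' = w(j := z)"
    have w': "w' \<in> I \<rightarrow> carrier G" using w z J by (auto simp: w'_def)
    have w'_insert: "int_comb G w' I e = z [^] e j \<otimes> int_comb G w J e" for e
    proof -
      have "int_comb G w' J e = int_comb G w J e"
        using w J w' by (intro int_comb_cong) (auto simp: w'_def)
      then show ?thesis using J w' by (simp add: int_comb_insert) (simp add: w'_def)
    qed
    have incl: "generate G (u ` J) \<subseteq> generate G (u ` I)" for u :: "_ \<Rightarrow> 'a"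
      using J by (intro mono_generate) auto
    have "generate G (w' ` I) = generate G (y' ` I)"
    proof (intro subset_antisym generate_image_subset w' y')
      fix i assume i: "i \<in> I"
      have im: "w' ` J = w ` J" "y' ` J = y ` J" using J by (auto simp: w'_def y'_def image_iff)
      show "w' i \<in> generate G (y' ` I)"
      proof (cases "i = j")
        case True
        then show ?thesis using j by (intro generate.incl) (auto simp: w'_def y'_def image_iff)
      next
        case False
        then have "w' i \<in> generate G (w ` J)" using i J by (intro generate.incl) (auto simp: w'_def)
        then show ?thesis using incl[of y'] w im by auto
      qed
      show "y' i \<in> generate G (w' ` I)"
      proof (cases "i = j")
        case True
        then show ?thesis using j by (intro generate.incl) (auto simp: w'_def y'_def image_iff)
      next
        case False
        then have "y' i \<in> generate G (y ` J)" using i J by (intro generate.incl) (auto simp: y'_def)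
        then show ?thesis using incl[of w'] w im by auto
      qed
    qed
    then have gen: "generate G (w' ` I) = generate G (x ` I)" using gen_y' by simp
    define d' where "d' = d(j := m)"
    have "int_comb G w' I e = \<one> \<longleftrightarrow> (\<forall>i\<in>I. int (d' i) dvd e i)" for e
    proof
      assume e: "int_comb G w' I e = \<one>"
      \<comment> \<open>The divisibility \<open>m_dvd\<close> concerns relations of
        \<open>y'\<close>, so the part over \<open>w\<close> is rewritten over \<open>y\<close>,
        which generates the same subgroup on \<open>J\<close>.\<close>
      have "int_comb G w J e \<in> generate G (y ` J)"
        using w J by (simp flip: w(2) add: generate_eq_int_comb)
      then obtain f where f: "int_comb G w J e = int_comb G y J f"
        using J yJ by (auto simp: generate_eq_int_comb)
      have "int_comb G y J (f(j := e j)) = int_comb G y J f"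
        using J yJ by (intro int_comb_cong) auto
      then have "int_comb G y' I (f(j := e j)) = \<one>"
        using e by (simp add: y'_insert w'_insert f)
      then have mj: "int m dvd e j" using m_dvd by fastforce
      then have "int_comb G w J e = \<one>" using e w by (simp add: w'_insert z_pow)
      then show "\<forall>i\<in>I. int (d' i) dvd e i" using mj d J by (auto simp: d'_def)
    next
      assume *: "\<forall>i\<in>I. int (d' i) dvd e i"
      then have "int m dvd e j" "\<forall>i\<in>J. int (d i) dvd e i"
        using J by (auto simp: d'_def split: if_splits)
      moreover from this have "int_comb G w J e = \<one>" using d by blast
      ultimately show "int_comb G w' I e = \<one>" by (simp add: w'_insert z_pow)
    qed
    then show ?thesis using gen w' by blast
  qed
qed

text \<open>Steinitz exchange: nonzero multiples of the \<open>x i\<close> are combinations of the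
  \<open>y j\<close>. With fewer \<open>y j\<close> than \<open>x i\<close> the coefficient matrix
  has a nontrivial left kernel, which yields a nontrivial relation of \<open>x\<close>.\<close>

lemma exchange_card_le:
  assumes "fam_independent G x I" "finite J" "y \<in> J \<rightarrow> carrier G" "x ` I \<subseteq> isolator G (y ` J)"
  shows "card I \<le> card J"
proof (rule ccontr)
  assume "\<not> card I \<le> card J"
  have I: "finite I" "x \<in> I \<rightarrow> carrier G" using assms(1) by (auto simp: fam_independent_def)
  have "\<exists>n a. n \<noteq> 0 \<and> x i [^] (n::int) = int_comb G y J a" if i: "i \<in> I" for i
  proof -
    obtain n :: int where "n \<noteq> 0" "x i [^] n \<in> range (int_comb G y J)"
      using assms(4) i
      unfolding isolator_def generate_eq_int_comb[OF assms(2,3)] by auto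
    then show ?thesis by blast
  qed
  then obtain n a where n: "\<And>i. i \<in> I \<Longrightarrow> n i \<noteq> 0"
    and a: "\<And>i. i \<in> I \<Longrightarrow> x i [^] (n i :: int) = int_comb G y J (a i)"
    by metis
  obtain c where c: "\<exists>i\<in>I. c i \<noteq> 0" "\<And>j. j \<in> J \<Longrightarrow> (\<Sum>i\<in>I. c i * a i j) = 0"
    using int_linear_system_nontrivial[of J I a] I assms(2) \<open>\<not> card I \<le> card J\<close>
    by (metis not_le)
  have "int_comb G x I (\<lambda>i. n i * c i) = int_comb G (\<lambda>i. x i [^] n i) I c"
    unfolding int_comb_def using I by (intro finprod_cong') (auto simp: int_pow_pow Pi_iff)
  also have "\<dots> = int_comb G y J (\<lambda>j. \<Sum>i\<in>I. c i * a i j)"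
    using I assms a by (intro int_comb_int_comb) auto
  also have "\<dots> = \<one>" using c by (intro int_comb_zero) auto
  finally have "\<forall>i\<in>I. n i * c i = 0" using assms(1) unfolding fam_independent_def by blast
  with c n show False by auto
qed

text \<open>Equal members at distinct indices would have the difference of two unit vectors as a
  nontrivial relation.\<close>

lemma fam_independent_inj:
  assumes "fam_independent G x I"
  shows "inj_on x I"
proof (rule inj_onI, rule ccontr)
  fix i j assume ij: "i \<in> I" "j \<in> I" "x i = x j" "i \<noteq> j"
  have I: "finite I" "x \<in> I \<rightarrow> carrier G" using assms by (auto simp: fam_independent_def)
  have "int_comb G x I (\<lambda>k. (if k = i then 1 else 0) - (if k = j then 1 else 0)) = \<one>"
    using I ij by (simp add: int_comb_diff_eq_one_iff int_comb_single)
  then have "(if i = i then 1 else 0) - (if i = j then 1 else 0) = (0::int)"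
    using assms ij(1) unfolding fam_independent_def by fast
  with ij show False by simp
qed

lemma int_independent_iff: "int_independent G S \<longleftrightarrow> fam_independent G (\<lambda>s. s) S"
  unfolding int_independent_def fam_independent_def int_comb_def by auto

lemma int_comb_reindex:
  assumes "inj_on x I" "x \<in> I \<rightarrow> carrier G"
  shows "int_comb G (\<lambda>s. s) (x ` I) c = int_comb G x I (\<lambda>i. c (x i))"
  unfolding int_comb_def using assms by (subst finprod_reindex) auto

lemma fam_independent_image:
  assumes "fam_independent G x I"
  shows "int_independent G (x ` I)" "card (x ` I) = card I"
proof -
  have I: "finite I" "x \<in> I \<rightarrow> carrier G" using assms by (auto simp: fam_independent_def)
  note inj = fam_independent_inj[OF assms]
  show "card (x ` I) = card I" using inj by (rule card_image)
  show "int_independent G (x ` I)"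
    unfolding int_independent_iff fam_independent_def
  proof (intro conjI allI impI)
    fix c assume "int_comb G (\<lambda>s. s) (x ` I) c = \<one>"
    then have "\<forall>i\<in>I. c (x i) = 0"
      using assms int_comb_reindex[OF inj I(2), of c] unfolding fam_independent_def by auto
    then show "\<forall>s\<in>x ` I. c s = 0" by blast
  qed (use I in auto)
qed

text \<open>By exchange no independent set is larger than \<open>I\<close>. This bounds the sizes
  under \<open>Max\<close>, and the image of \<open>x\<close> attains the bound.\<close>

lemma ab_rank_eqI:
  assumes "fam_independent G x I" "carrier G \<subseteq> isolator G (x ` I)"
  shows "ab_rank G = card I"
  unfolding ab_rank_def
proof (rule Max_eqI)
  have I: "finite I" "x \<in> I \<rightarrow> carrier G" using assms by (auto simp: fam_independent_def)
  have le: "card S \<le> card I" if "int_independent G S" for S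
    using that assms(2) I
    by (intro exchange_card_le[of "\<lambda>s. s" S I x]) (auto simp: int_independent_iff fam_independent_def)
  then show "\<And>k. k \<in> card ` {S. int_independent G S} \<Longrightarrow> k \<le> card I" by auto
  have "card ` {S. int_independent G S} \<subseteq> {..card I}" using le by auto
  then show "finite (card ` {S. int_independent G S})" by (rule finite_subset) simp
  show "card I \<in> card ` {S. int_independent G S}"
    by (rule image_eqI[of _ _ "x ` I"]) (use fam_independent_image[OF assms(1)] in auto)
qed

end

section \<open>Homomorphisms into a finite group, and torsion\<close>

text \<open>The group is the direct sum of cyclic groups of order \<open>d i\<close>, where \<open>d i = 0\<close> stands for an
  infinite cyclic summand; trivial summands with \<open>d i = 1\<close> are allowed.\<close>

locale cyclic_generators = comm_group G for G (structure) +
  fixes I :: "'i set" and x :: "'i \<Rightarrow> 'a" and d :: "'i \<Rightarrow> nat"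
  assumes finite_index: "finite I"
    and gen_carrier: "x \<in> I \<rightarrow> carrier G"
    and gen_surj: "carrier G = range (int_comb G x I)"
    and relation_iff: "int_comb G x I c = \<one> \<longleftrightarrow> (\<forall>i\<in>I. int (d i) dvd c i)"

lemma (in comm_group) fin_generated_cyclic_generators:
  assumes "fin_generated G"
  obtains I :: "'a set" and x d where "cyclic_generators G I x d"
proof -
  obtain S where S: "finite S" "S \<subseteq> carrier G" "generate G S = carrier G"
    using assms by (auto simp: fin_generated_def)
  then obtain x d where x: "x \<in> S \<rightarrow> carrier G" "generate G (x ` S) = carrier G"
    and d: "\<And>c. int_comb G x S c = \<one> \<longleftrightarrow> (\<forall>i\<in>S. int (d i) dvd c i)"
    using cyclic_decomposition[of S "\<lambda>s. s"] by (auto simp: Pi_iff subset_iff)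
  have "cyclic_generators G S x d"
    by unfold_locales (use S x d generate_eq_int_comb[OF S(1) x(1)] in auto)
  then show ?thesis by (rule that)
qed

section \<open>Rank, torsion and homomorphisms of a sum of cyclic groups\<close>

context cyclic_generators
begin

definition free_index :: "'i set" where "free_index = {i \<in> I. d i = 0}"

lemma fam_independent_free: "fam_independent G x free_index"
  unfolding fam_independent_def
proof (intro conjI allI impI)
  fix c assume c: "int_comb G x free_index c = \<one>"
  \<comment> \<open>Extension by zero to all of \<open>I\<close> makes the relation criterion
    applicable; divisibility by \<open>d i = 0\<close> then means vanishing.\<close>
  have "int_comb G x I (\<lambda>i. if d i = 0 then c i else 0) =
      int_comb G x free_index (\<lambda>i. if d i = 0 then c i else 0)"
    using finite_index gen_carrier by (rule int_comb_subset) (auto simp: free_index_def)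
  also have "\<dots> = int_comb G x free_index c"
    using gen_carrier by (intro int_comb_cong) (auto simp: free_index_def)
  also have "\<dots> = \<one>" by (rule c)
  finally have "\<forall>i\<in>I. int (d i) dvd (if d i = 0 then c i else 0)"
    unfolding relation_iff .
  then show "\<forall>i\<in>free_index. c i = 0" by (auto simp: free_index_def split: if_splits)
qed (use finite_index gen_carrier in \<open>auto simp: free_index_def\<close>)

text \<open>Multiplication by the product \<open>N\<close> of the nonzero \<open>d i\<close> kills
  all finite cyclic summands and leaves only free coordinates.\<close>

lemma isolator_free: "carrier G \<subseteq> isolator G (x ` free_index)"
proof
  fix y assume y: "y \<in> carrier G"
  then obtain c where c: "y = int_comb G x I c" using gen_surj by auto
  define N where "N = int (\<Prod>i\<in>I - free_index. d i)"
  have N: "N \<noteq> 0" using finite_index by (auto simp: N_def free_index_def)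
  have "int (d i) dvd N" if "i \<in> I - free_index" for i
    unfolding N_def int_dvd_int_iff using that finite_index by (intro dvd_prodI) auto
  then have "int_comb G x I (\<lambda>i. c i * N - (if d i = 0 then c i * N else 0)) = \<one>"
    by (auto simp: relation_iff free_index_def)
  then have "int_comb G x I (\<lambda>i. c i * N) = int_comb G x I (\<lambda>i. if d i = 0 then c i * N else 0)"
    using finite_index gen_carrier by (subst (asm) int_comb_diff_eq_one_iff) auto
  also have "\<dots> = int_comb G x free_index (\<lambda>i. if d i = 0 then c i * N else 0)"
    using finite_index gen_carrier by (rule int_comb_subset) (auto simp: free_index_def)
  finally have "y [^] N = int_comb G x free_index (\<lambda>i. if d i = 0 then c i * N else 0)"
    using c finite_index gen_carrier by (simp add: int_comb_scale)
  then have "y [^] N \<in> generate G (x ` free_index)"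
    using fam_independent_free by (subst generate_eq_int_comb) (auto simp: fam_independent_def)
  then show "y \<in> isolator G (x ` free_index)" using y N by (auto simp: isolator_def)
qed

lemma ab_rank_eq: "ab_rank G = card free_index"
  using ab_rank_eqI[OF fam_independent_free isolator_free] .

text \<open>A torsion element has coordinate zero in each infinite summand, and its other
  coordinates may be reduced modulo \<open>d i\<close>.\<close>

lemma finite_torsion_part: "finite (torsion_part G)"
proof (rule finite_subset)
  \<comment> \<open>The upper end \<open>d i\<close> is included so that the range is
    \<open>{0}\<close>, not empty, where \<open>d i = 0\<close>.\<close>
  show "finite (int_comb G x I ` (PiE I (\<lambda>i. {0..int (d i)})))"
    using finite_index by (intro finite_imageI finite_PiE) auto
  show "torsion_part G \<subseteq> int_comb G x I ` (PiE I (\<lambda>i. {0..int (d i)}))"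
  proof
    fix y assume y: "y \<in> torsion_part G"
    then obtain c where c: "y = int_comb G x I c" using gen_surj by (auto simp: torsion_part_def)
    obtain n :: nat where n: "n > 0" "y [^] n = \<one>" using y by (auto simp: torsion_part_def)
    have "int_comb G x I (\<lambda>i. c i * int n) = \<one>"
      using n finite_index gen_carrier by (simp add: int_comb_scale int_pow_int flip: c)
    then have dvd: "\<forall>i\<in>I. int (d i) dvd c i * int n" by (simp add: relation_iff)
    define c' where "c' = (\<lambda>i\<in>I. c i mod int (d i))"
    have "c' \<in> PiE I (\<lambda>i. {0..int (d i)})"
    proof
      fix i assume i: "i \<in> I"
      show "c' i \<in> {0..int (d i)}"
      proof (cases "d i = 0")
        case True
        then have "c i = 0" using dvd i n by auto
        then show ?thesis using i by (simp add: c'_def)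
      next
        case False
        then show ?thesis using i by (simp add: c'_def order_less_imp_le)
      qed
    qed (auto simp: c'_def)
    moreover have "int_comb G x I c = int_comb G x I c'"
      using finite_index gen_carrier
      by (subst int_comb_diff_eq_one_iff[symmetric]) (auto simp: relation_iff c'_def)
    ultimately show "y \<in> int_comb G x I ` (PiE I (\<lambda>i. {0..int (d i)}))" using c by blast
  qed
qed

text \<open>Universal property of the direct sum: the images of the generators may be prescribed
  subject only to the relations of order \<open>d i\<close>, and for \<open>d i = 0\<close> this is
  no condition.\<close>

lemma bij_betw_Hom_set:
  assumes "comm_group H"
  shows "bij_betw (\<lambda>\<phi>. \<lambda>i\<in>I. \<phi> (x i)) (Hom_set G H)
    (PiE I (\<lambda>i. {h \<in> carrier H. h [^]\<^bsub>H\<^esub> d i = \<one>\<^bsub>H\<^esub>}))"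
  unfolding bij_betw_def
proof
  interpret H: comm_group H by fact
  have G: "comm_group G" by unfold_locales
  have hom_comb: "\<phi> (int_comb G x I c) = int_comb H (\<lambda>i. \<phi> (x i)) I c" if "\<phi> \<in> Hom_set G H" for \<phi> c
    using that finite_index gen_carrier assms G by (intro int_comb_hom) (auto simp: Hom_set_def)
  show "inj_on (\<lambda>\<phi>. \<lambda>i\<in>I. \<phi> (x i)) (Hom_set G H)"
  proof (rule inj_onI)
    fix \<phi> \<psi> assume *: "\<phi> \<in> Hom_set G H" "\<psi> \<in> Hom_set G H" "(\<lambda>i\<in>I. \<phi> (x i)) = (\<lambda>i\<in>I. \<psi> (x i))"
    have eq: "\<phi> (x i) = \<psi> (x i)" if "i \<in> I" for i
      using fun_cong[OF *(3), of i] that by simp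
    show "\<phi> = \<psi>"
    proof (rule extensionalityI)
      show "\<phi> \<in> extensional (carrier G)" "\<psi> \<in> extensional (carrier G)"
        using * by (auto simp: Hom_set_def)
      fix y assume "y \<in> carrier G"
      then obtain c where "y = int_comb G x I c" using gen_surj by auto
      moreover have "int_comb H (\<lambda>i. \<phi> (x i)) I c = int_comb H (\<lambda>i. \<psi> (x i)) I c"
        by (rule H.int_comb_cong) (use eq *(1) gen_carrier in \<open>auto simp: Hom_set_def Pi_iff dest: hom_in_carrier\<close>)
      ultimately show "\<phi> y = \<psi> y" using hom_comb * by simp
    qed
  qed
  show "(\<lambda>\<phi>. \<lambda>i\<in>I. \<phi> (x i)) ` Hom_set G H =
      PiE I (\<lambda>i. {h \<in> carrier H. h [^]\<^bsub>H\<^esub> d i = \<one>\<^bsub>H\<^esub>})" (is "_ = ?P")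
  proof (intro subset_antisym subsetI)
    fix t assume "t \<in> (\<lambda>\<phi>. \<lambda>i\<in>I. \<phi> (x i)) ` Hom_set G H"
    then obtain \<phi> where \<phi>: "\<phi> \<in> Hom_set G H" "t = (\<lambda>i\<in>I. \<phi> (x i))" by auto
    then have hom: "\<phi> \<in> hom G H" by (simp add: Hom_set_def)
    have "\<phi> (x i) [^]\<^bsub>H\<^esub> d i = \<one>\<^bsub>H\<^esub>" if i: "i \<in> I" for i
    proof -
      have xi: "x i \<in> carrier G" using i gen_carrier by auto
      have "int_comb G x I (\<lambda>j. if j = i then int (d i) else 0) = \<one>"
        by (auto simp: relation_iff)
      then have "x i [^] d i = \<one>"
        using i finite_index gen_carrier by (simp add: int_comb_single int_pow_int)
      then have "\<phi> (x i [^] d i) = \<one>\<^bsub>H\<^esub>"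
        using hom by (simp add: hom_one is_group H.is_group)
      then show ?thesis using hom_nat_pow[OF hom xi, of "d i"] by (simp add: is_group H.is_group)
    qed
    then show "t \<in> ?P" using \<phi> gen_carrier by (auto simp: Pi_iff dest: hom_in_carrier[OF hom])
  next
    fix t assume t: "t \<in> ?P"
    then have tc: "t \<in> I \<rightarrow> carrier H" by auto
    \<comment> \<open>An arbitrary coefficient vector of \<open>y\<close> is chosen. The value does
      not depend on it, because two choices differ by multiples of \<open>d i\<close>, which act
      trivially on \<open>t i\<close>.\<close>
    define \<phi> where "\<phi> = (\<lambda>y\<in>carrier G. int_comb H t I (SOME c. int_comb G x I c = y))"
    have \<phi>: "\<phi> (int_comb G x I c) = int_comb H t I c" for c
    proof -
      define c' where "c' = (SOME c'. int_comb G x I c' = int_comb G x I c)"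
      have "int_comb G x I c' = int_comb G x I c"
        unfolding c'_def by (rule someI[of _ c]) simp
      then have dvd: "\<forall>i\<in>I. int (d i) dvd c' i - c i"
        using finite_index gen_carrier by (simp flip: int_comb_diff_eq_one_iff add: relation_iff)
      have "t i [^]\<^bsub>H\<^esub> (c' i - c i) = \<one>\<^bsub>H\<^esub>" if i: "i \<in> I" for i
      proof -
        obtain k where k: "c' i - c i = int (d i) * k" using dvd i by (auto elim: dvdE)
        have "t i [^]\<^bsub>H\<^esub> (int (d i) * k) = (t i [^]\<^bsub>H\<^esub> int (d i)) [^]\<^bsub>H\<^esub> k"
          using tc i by (subst H.int_pow_pow) auto
        also have "t i [^]\<^bsub>H\<^esub> int (d i) = \<one>\<^bsub>H\<^esub>" using t i by (auto simp: int_pow_int)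
        finally show ?thesis using k by simp
      qed
      then have "int_comb H t I (\<lambda>i. c' i - c i) = \<one>\<^bsub>H\<^esub>"
        unfolding int_comb_def by (intro H.finprod_one_eqI) auto
      then have "int_comb H t I c' = int_comb H t I c"
        using finite_index tc by (subst (asm) H.int_comb_diff_eq_one_iff) auto
      then show ?thesis using gen_carrier by (simp add: \<phi>_def c'_def)
    qed
    have "\<phi> \<in> hom G H"
    proof (rule homI)
      fix y assume "y \<in> carrier G"
      then obtain c where "y = int_comb G x I c" using gen_surj by auto
      then show "\<phi> y \<in> carrier H" using \<phi> tc by simp
      fix z assume "z \<in> carrier G"
      then obtain e where "z = int_comb G x I e" using gen_surj by auto
      then show "\<phi> (y \<otimes> z) = \<phi> y \<otimes>\<^bsub>H\<^esub> \<phi> z"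
        using \<open>y = int_comb G x I c\<close> gen_carrier tc \<phi>
        by (simp flip: int_comb_add H.int_comb_add)
    qed
    then have "\<phi> \<in> Hom_set G H" by (simp add: Hom_set_def \<phi>_def)
    moreover have "t = (\<lambda>i\<in>I. \<phi> (x i))"
    proof (rule extensionalityI[of _ I])
      fix i assume i: "i \<in> I"
      have "\<phi> (x i) = int_comb H t I (\<lambda>j. if j = i then 1 else 0)"
        using \<phi>[of "\<lambda>j. if j = i then 1 else 0"] i finite_index gen_carrier by (simp add: int_comb_single Pi_iff)
      also have "\<dots> = t i" using i finite_index tc by (simp add: H.int_comb_single Pi_iff)
      finally show "t i = (\<lambda>i\<in>I. \<phi> (x i)) i" using i by simp
    qed (use t in \<open>auto simp: PiE_def\<close>)
    ultimately show "t \<in> (\<lambda>\<phi>. \<lambda>i\<in>I. \<phi> (x i)) ` Hom_set G H" by blast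
  qed
qed

end

text \<open>Sylow's theorem with exponent one, where the cofactor \<open>m\<close> may still contain
  \<open>p\<close>, gives a subgroup of order \<open>p\<close>; any nontrivial element of it will
  do.\<close>

lemma (in group) cauchy_prime_order:
  assumes "finite (carrier G)" "Factorial_Ring.prime p" "p dvd order G"
  obtains y where "y \<in> carrier G" "y \<noteq> \<one>" "y [^] p = \<one>"
proof -
  obtain m where "order G = p ^ 1 * m" using assms by (auto elim: dvdE)
  then obtain P where P: "subgroup P G" "card P = p ^ 1"
    using sylow_thm[OF assms(2) is_group _ assms(1), of 1 m] by blast
  interpret P: group "G\<lparr>carrier := P\<rparr>" using P by (intro subgroup.subgroup_is_group is_group)
  have "card P > 1" using P assms prime_gt_1_nat by simp
  then obtain y where y: "y \<in> P" "y \<noteq> \<one>"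
    by (metis card_eq_0_iff card_1_singleton_iff gr_implies_not_zero is_singletonI' is_singleton_altdef less_irrefl empty_iff card.empty)
  have "y [^]\<^bsub>G\<lparr>carrier := P\<rparr>\<^esub> order (G\<lparr>carrier := P\<rparr>) = \<one>"
    using P.pow_order_eq_1[of y] y by simp
  then have "y [^] p = \<one>"
    using P by (simp add: order_def nat_pow_def)
  with y P show ?thesis using that subgroup.subset by blast
qed

text \<open>A common prime factor yields a nontrivial solution by Cauchy's theorem. Conversely, the
  order of a solution divides both \<open>n\<close> and the group order.\<close>

lemma (in group) card_pow_eq_one_eq_1_iff:
  assumes "finite (carrier G)"
  shows "card {h \<in> carrier G. h [^] n = \<one>} = 1 \<longleftrightarrow> coprime n (order G)"
proof
  assume "card {h \<in> carrier G. h [^] n = \<one>} = 1"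
  moreover have "\<one> \<in> {h \<in> carrier G. h [^] n = \<one>}" by simp
  ultimately have triv: "h = \<one>" if "h \<in> carrier G" "h [^] n = \<one>" for h
    using that by (metis (mono_tags, lifting) card_1_singletonE mem_Collect_eq singletonD)
  show "coprime n (order G)"
  proof (rule ccontr)
    assume "\<not> coprime n (order G)"
    then obtain p where p: "Factorial_Ring.prime p" "p dvd n" "p dvd order G"
      using prime_factor_nat[of "gcd n (order G)"] by (auto simp: coprime_iff_gcd_eq_1)
    obtain y where y: "y \<in> carrier G" "y \<noteq> \<one>" "y [^] p = \<one>"
      using cauchy_prime_order[OF assms p(1,3)] by blast
    then have "y [^] n = \<one>" using p by (metis pow_eq_id dvd_trans)
    then show False using triv y by blast
  qed
next
  assume "coprime n (order G)"
  have "h = \<one>" if "h \<in> carrier G" "h [^] n = \<one>" for h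
  proof -
    have "ord h dvd n" "ord h dvd order G" using that pow_eq_id ord_dvd_group_order by auto
    then have "ord h = 1" using \<open>coprime n (order G)\<close> by (metis coprime_common_divisor nat_dvd_1_iff_1)
    then show ?thesis using that ord_eq_1 by blast
  qed
  then have "{h \<in> carrier G. h [^] n = \<one>} = {\<one>}" by auto
  then show "card {h \<in> carrier G. h [^] n = \<one>} = 1" by simp
qed

text \<open>Used for primes \<open>p\<close>. In contrast to coprimality with the size of the
  torsion part, this is an elementwise condition, which can be carried from one quotient to
  another.\<close>

definition no_torsion_at :: "('a, 'b) monoid_scheme \<Rightarrow> nat \<Rightarrow> bool" where
  "no_torsion_at G p \<longleftrightarrow> (\<forall>y\<in>carrier G. y [^]\<^bsub>G\<^esub> p = \<one>\<^bsub>G\<^esub> \<longrightarrow> y = \<one>\<^bsub>G\<^esub>)"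

section \<open>Homomorphism counts and torsion at primes\<close>

context cyclic_generators
begin

lemma finite_Hom_set:
  assumes "comm_group H" "finite (carrier H)"
  shows "finite (Hom_set G H)"
  using bij_betw_finite[OF bij_betw_Hom_set[OF assms(1)]] finite_index assms(2)
  by (simp add: finite_PiE)

lemma card_Hom_set:
  assumes "comm_group H"
  shows "card (Hom_set G H) = (\<Prod>i\<in>I. card {h \<in> carrier H. h [^]\<^bsub>H\<^esub> d i = \<one>\<^bsub>H\<^esub>})"
  using bij_betw_same_card[OF bij_betw_Hom_set[OF assms]] finite_index by (simp add: card_PiE)

text \<open>If \<open>d i = p * k\<close> is positive, then the \<open>k\<close>-th power of
  \<open>x i\<close> is a nontrivial element killed by \<open>p\<close>. Conversely, coprimality
  cancels \<open>p\<close> when \<open>d i\<close> divides \<open>c i * p\<close>.\<close>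

lemma no_torsion_at_iff_coprime:
  assumes "q > 0"
  shows "(\<forall>p. Factorial_Ring.prime p \<longrightarrow> p dvd q \<longrightarrow> no_torsion_at G p) \<longleftrightarrow>
    (\<forall>i\<in>I - free_index. coprime (d i) q)"
proof (intro iffI ballI allI impI)
  fix i assume *: "\<forall>p. Factorial_Ring.prime p \<longrightarrow> p dvd q \<longrightarrow> no_torsion_at G p"
    and i: "i \<in> I - free_index"
  have xi: "x i \<in> carrier G" using i gen_carrier by auto
  have pow: "x i [^] k = \<one> \<longleftrightarrow> d i dvd k" for k :: nat
  proof -
    have "x i [^] k = int_comb G x I (\<lambda>j. if j = i then int k else 0)"
      using i finite_index gen_carrier by (simp add: int_comb_single int_pow_int)
    then show ?thesis using i by (auto simp: relation_iff)
  qed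
  show "coprime (d i) q"
  proof (rule ccontr)
    assume "\<not> coprime (d i) q"
    then obtain p where p: "Factorial_Ring.prime p" "p dvd d i" "p dvd q"
      using prime_factor_nat[of "gcd (d i) q"] by (auto simp: coprime_iff_gcd_eq_1)
    then obtain k where k: "d i = p * k" by (auto elim: dvdE)
    have "(x i [^] k) [^] p = \<one>" using xi k pow[of "d i"] by (simp add: nat_pow_pow mult.commute)
    then have "x i [^] k = \<one>" using * p xi by (auto simp: no_torsion_at_def)
    then have "p * k dvd k" using pow k by simp
    moreover have "k > 0" using i k by (auto simp: free_index_def intro!: Nat.gr0I)
    ultimately show False using p prime_gt_1_nat[of p] by (auto dest: dvd_imp_le)
  qed
next
  fix p assume *: "\<forall>i\<in>I - free_index. coprime (d i) q" and p: "Factorial_Ring.prime p" "p dvd q"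
  show "no_torsion_at G p"
    unfolding no_torsion_at_def
  proof (intro ballI impI)
    fix y assume y: "y \<in> carrier G" "y [^] p = \<one>"
    then obtain c where c: "y = int_comb G x I c" using gen_surj by auto
    have "int_comb G x I (\<lambda>i. c i * int p) = \<one>"
      using y finite_index gen_carrier by (simp add: int_comb_scale int_pow_int flip: c)
    then have dvd: "int (d i) dvd c i * int p" if "i \<in> I" for i using that by (simp add: relation_iff)
    have "int (d i) dvd c i" if i: "i \<in> I" for i
    proof (cases "i \<in> free_index")
      case True
      then show ?thesis using dvd[OF i] p prime_gt_0_nat[of p] by (auto simp: free_index_def)
    next
      case False
      then have "coprime (d i) p" using * p i by (meson DiffI coprime_divisors dvd_refl)
      then have "coprime (int (d i)) (int p)" by simp
      then show ?thesis using dvd[OF i] by (simp add: coprime_dvd_mult_left_iff)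
    qed
    then show "y = \<one>" using c by (simp add: relation_iff)
  qed
qed

text \<open>Each infinite summand contributes exactly one factor \<open>order H\<close>, which
  accounts for the power. The remaining factors are natural numbers, so their product is 1 only if
  each of them is.\<close>

lemma card_Hom_set_eq_iff_no_torsion:
  assumes "comm_group H" "finite (carrier H)"
  shows "card (Hom_set G H) = order H ^ ab_rank G \<longleftrightarrow>
    (\<forall>p. Factorial_Ring.prime p \<longrightarrow> p dvd order H \<longrightarrow> no_torsion_at G p)"
proof -
  interpret H: comm_group H by fact
  have q: "order H > 0" using assms H.one_closed by (auto simp: order_def card_gt_0_iff)
  define k where "k n = card {h \<in> carrier H. h [^]\<^bsub>H\<^esub> (n::nat) = \<one>\<^bsub>H\<^esub>}" for n
  have "card (Hom_set G H) = (\<Prod>i\<in>I. k (d i))" using card_Hom_set[OF assms(1)] by (simp add: k_def)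
  also have "\<dots> = (\<Prod>i\<in>free_index. k (d i)) * (\<Prod>i\<in>I - free_index. k (d i))"
    using finite_index by (subst prod.subset_diff[of free_index]) (auto simp: free_index_def mult.commute)
  also have "(\<Prod>i\<in>free_index. k (d i)) = (\<Prod>i\<in>free_index. order H)"
    by (intro prod.cong) (auto simp: free_index_def k_def order_def)
  also have "\<dots> = order H ^ ab_rank G" by (simp add: ab_rank_eq)
  finally have "card (Hom_set G H) = order H ^ ab_rank G \<longleftrightarrow> (\<Prod>i\<in>I - free_index. k (d i)) = 1"
    using q by simp
  also have "\<dots> \<longleftrightarrow> (\<forall>i\<in>I - free_index. k (d i) = 1)"
    using finite_index by (subst prod_eq_1_iff) auto
  also have "\<dots> \<longleftrightarrow> (\<forall>i\<in>I - free_index. coprime (d i) (order H))"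
    using H.card_pow_eq_one_eq_1_iff[OF assms(2)] by (simp add: k_def)
  finally show ?thesis using no_torsion_at_iff_coprime[OF q] by simp
qed

end

lemma (in comm_group) subgroup_torsion_part: "subgroup (torsion_part G) G"
proof
  show "torsion_part G \<subseteq> carrier G" by (auto simp: torsion_part_def)
  show "\<one> \<in> torsion_part G" by (auto simp: torsion_part_def intro: exI[of _ 1])
  fix y assume "y \<in> torsion_part G"
  then obtain n :: nat where n: "y \<in> carrier G" "n > 0" "y [^] n = \<one>" by (auto simp: torsion_part_def)
  then show "inv y \<in> torsion_part G" by (auto simp: torsion_part_def nat_pow_inv intro!: exI[of _ n])
  fix z assume "z \<in> torsion_part G"
  then obtain m :: nat where m: "z \<in> carrier G" "m > 0" "z [^] m = \<one>" by (auto simp: torsion_part_def)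
  have "(y \<otimes> z) [^] (n * m) = \<one>"
    using n m by (simp add: nat_pow_distrib flip: nat_pow_pow) (metis mult.commute nat_pow_one nat_pow_pow)
  then show "y \<otimes> z \<in> torsion_part G" using n m
    by (auto simp: torsion_part_def intro!: exI[of _ "n * m"])
qed

text \<open>Cauchy's and Lagrange's theorems, applied to the torsion subgroup, which contains every
  element killed by a prime.\<close>

lemma (in comm_group) coprime_card_torsion_part_iff:
  assumes "finite (torsion_part G)" "q > 0"
  shows "coprime q (card (torsion_part G)) \<longleftrightarrow>
    (\<forall>p. Factorial_Ring.prime p \<longrightarrow> p dvd q \<longrightarrow> no_torsion_at G p)"
proof -
  define T where "T = G\<lparr>carrier := torsion_part G\<rparr>"
  interpret T: group T
    unfolding T_def by (intro subgroup.subgroup_is_group subgroup_torsion_part is_group)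
  have T: "carrier T = torsion_part G" "order T = card (torsion_part G)" "\<one>\<^bsub>T\<^esub> = \<one>"
    by (simp_all add: T_def order_def)
  have pow: "y [^]\<^bsub>T\<^esub> n = y [^] n" for y and n :: nat by (simp add: T_def nat_pow_def)
  have "no_torsion_at G p \<longleftrightarrow> \<not> p dvd card (torsion_part G)" if p: "Factorial_Ring.prime p" for p
  proof
    assume *: "no_torsion_at G p"
    show "\<not> p dvd card (torsion_part G)"
    proof
      assume "p dvd card (torsion_part G)"
      then obtain y where "y \<in> torsion_part G" "y \<noteq> \<one>" "y [^] p = \<one>"
        using T.cauchy_prime_order[of p] p assms by (auto simp: T pow)
      then show False using * by (auto simp: no_torsion_at_def torsion_part_def)
    qed
  next
    assume *: "\<not> p dvd card (torsion_part G)"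
    show "no_torsion_at G p"
      unfolding no_torsion_at_def
    proof (intro ballI impI)
      fix y assume y: "y \<in> carrier G" "y [^] p = \<one>"
      then have "y \<in> carrier T" using prime_gt_0_nat[OF p] by (auto simp: T torsion_part_def)
      then have "T.ord y dvd p" "T.ord y dvd card (torsion_part G)"
        using y T.pow_eq_id[of y p] T.ord_dvd_group_order[of y] by (auto simp: T pow)
      then have "T.ord y = 1" using * p by (metis prime_nat_iff)
      then show "y = \<one>" using T.ord_eq_1 \<open>y \<in> carrier T\<close> by (simp add: T)
    qed
  qed
  moreover have "coprime q n \<longleftrightarrow> (\<forall>p. Factorial_Ring.prime p \<longrightarrow> p dvd q \<longrightarrow> \<not> p dvd n)" for n
  proof
    assume "coprime q n"
    then show "\<forall>p. Factorial_Ring.prime p \<longrightarrow> p dvd q \<longrightarrow> \<not> p dvd n"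
      by (metis coprime_common_divisor_nat not_prime_1 nat_dvd_1_iff_1)
  next
    assume "\<forall>p. Factorial_Ring.prime p \<longrightarrow> p dvd q \<longrightarrow> \<not> p dvd n"
    then show "coprime q n"
      using prime_factor_nat[of "gcd q n"] by (auto simp: coprime_iff_gcd_eq_1)
  qed
  ultimately show ?thesis by simp
qed

lemma (in comm_group) card_Hom_set_eq_iff:
  assumes "fin_generated G" "comm_group H" "finite (carrier H)"
  shows "card (Hom_set G H) = order H ^ ab_rank G \<longleftrightarrow> coprime (order H) (card (torsion_part G))"
proof -
  interpret H: comm_group H by fact
  have q: "order H > 0" using assms H.one_closed by (auto simp: order_def card_gt_0_iff)
  obtain I :: "'a set" and x d where "cyclic_generators G I x d"
    using fin_generated_cyclic_generators[OF assms(1)] .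
  then interpret C: cyclic_generators G I x d .
  show ?thesis
    using C.card_Hom_set_eq_iff_no_torsion[OF assms(2,3)] coprime_card_torsion_part_iff[OF C.finite_torsion_part q]
    by simp
qed

lemma (in comm_group) fin_generated_finite_Hom_set:
  assumes "fin_generated G" "comm_group H" "finite (carrier H)"
  shows "finite (Hom_set G H)"
proof -
  obtain I :: "'a set" and x d where "cyclic_generators G I x d"
    using fin_generated_cyclic_generators[OF assms(1)] .
  then show ?thesis by (rule cyclic_generators.finite_Hom_set) fact+
qed

lemma (in comm_group) ex_rank_family:
  assumes "fin_generated G"
  obtains I :: "'a set" and x where "fam_independent G x I" "carrier G \<subseteq> isolator G (x ` I)"
proof -
  obtain I :: "'a set" and x d where "cyclic_generators G I x d"
    using fin_generated_cyclic_generators[OF assms(1)] .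
  then interpret C: cyclic_generators G I x d .
  show ?thesis using that C.fam_independent_free C.isolator_free by blast
qed

section \<open>Additivity of the rank\<close>

context comm_group
begin

text \<open>The disjoint sum of index sets allows two families with different index types to be
  joined into one.\<close>

lemma int_comb_Plus:
  assumes "finite I" "finite J" "x \<in> I \<rightarrow> carrier G" "y \<in> J \<rightarrow> carrier G"
  shows "int_comb G (case_sum x y) (I <+> J) c = int_comb G x I (c \<circ> Inl) \<otimes> int_comb G y J (c \<circ> Inr)"
proof -
  let ?f = "\<lambda>k. case_sum x y k [^] c k"
  have f: "?f \<in> Inl ` I \<rightarrow> carrier G" "?f \<in> Inr ` J \<rightarrow> carrier G"
    using assms by (auto simp: Pi_iff)
  have "int_comb G (case_sum x y) (I <+> J) c = finprod G ?f (Inl ` I) \<otimes> finprod G ?f (Inr ` J)"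
    unfolding int_comb_def Plus_def using assms f by (intro finprod_Un_disjoint) auto
  also have "finprod G ?f (Inl ` I) = int_comb G x I (c \<circ> Inl)"
    unfolding int_comb_def using f by (subst finprod_reindex) auto
  also have "finprod G ?f (Inr ` J) = int_comb G y J (c \<circ> Inr)"
    unfolding int_comb_def using f by (subst finprod_reindex) auto
  finally show ?thesis .
qed

text \<open>If \<open>n\<close> and \<open>m\<close> are suitable exponents for two elements, then
  \<open>n * m\<close> is one for their product, by commutativity.\<close>

lemma subgroup_isolator:
  assumes "T \<subseteq> carrier G"
  shows "subgroup (isolator G T) G"
proof
  have T: "subgroup (generate G T) G" using assms by (rule generate_is_subgroup)
  show "isolator G T \<subseteq> carrier G" by (auto simp: isolator_def)
  show "\<one> \<in> isolator G T" by (auto simp: isolator_def intro!: exI[of _ 1] generate.one)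
  fix y assume "y \<in> isolator G T"
  then obtain n :: int where n: "y \<in> carrier G" "n \<noteq> 0" "y [^] n \<in> generate G T"
    by (auto simp: isolator_def)
  then have "inv y [^] n \<in> generate G T" using T by (simp add: int_pow_inv subgroup.m_inv_closed)
  then show "inv y \<in> isolator G T" using n by (auto simp: isolator_def)
  fix z assume "z \<in> isolator G T"
  then obtain m :: int where m: "z \<in> carrier G" "m \<noteq> 0" "z [^] m \<in> generate G T"
    by (auto simp: isolator_def)
  have "(y \<otimes> z) [^] (n * m) = (y [^] n) [^] m \<otimes> (z [^] m) [^] n"
    using n m by (simp add: int_pow_distrib int_pow_pow mult.commute)
  also have "\<dots> \<in> generate G T"
    using subgroup_int_pow_closed[OF T n(3), of m] subgroup_int_pow_closed[OF T m(3), of n]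
    by (rule generate.eng)
  finally show "y \<otimes> z \<in> isolator G T"
    using n m unfolding isolator_def by (auto intro!: exI[of _ "n * m"])
qed

lemma generate_subset_isolator:
  assumes "T \<subseteq> carrier G" "S \<subseteq> isolator G T"
  shows "generate G S \<subseteq> isolator G T"
  using assms by (intro generate_subgroup_incl subgroup_isolator)

lemma generate_le_isolator:
  assumes "T \<subseteq> carrier G"
  shows "generate G T \<subseteq> isolator G T"
proof (rule generate_subset_isolator[OF assms], rule subsetI)
  fix t assume "t \<in> T"
  then show "t \<in> isolator G T"
    using assms by (auto simp: isolator_def intro!: exI[of _ 1] generate.incl)
qed

lemma subgroup_comm_group: "subgroup N G \<Longrightarrow> comm_group (G\<lparr>carrier := N\<rparr>)"
  by (intro group.group_comm_groupI subgroup_imp_group)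
    (auto intro: m_comm dest: subgroup.mem_carrier)

text \<open>The inclusion is a homomorphism. Independence and isolators in a subgroup can therefore
  be treated in \<open>G\<close>.\<close>

lemma int_comb_subgroup:
  assumes "subgroup N G" "finite I" "x \<in> I \<rightarrow> N"
  shows "int_comb (G\<lparr>carrier := N\<rparr>) x I c = int_comb G x I c"
proof -
  have "(\<lambda>y. y) \<in> hom (G\<lparr>carrier := N\<rparr>) G"
    using assms(1) by (auto simp: hom_def dest: subgroup.mem_carrier)
  then show ?thesis
    using int_comb_hom[OF subgroup_comm_group[OF assms(1)] comm_group_axioms, of "\<lambda>y. y" I x c] assms
    by auto
qed

lemma fam_independent_subgroup:
  assumes "subgroup N G" "x \<in> I \<rightarrow> N"
  shows "fam_independent (G\<lparr>carrier := N\<rparr>) x I \<longleftrightarrow> fam_independent G x I"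
  using assms int_comb_subgroup[of N I x] subgroup.subset[OF assms(1)]
  by (auto simp: fam_independent_def Pi_iff)

lemma isolator_subgroup:
  assumes "subgroup N G" "T \<subseteq> N"
  shows "isolator (G\<lparr>carrier := N\<rparr>) T = isolator G T \<inter> N"
  using assms int_pow_consistent[OF assms(1)] generate_consistent[OF assms(2,1)] subgroup.subset[OF assms(1)]
  by (auto simp: isolator_def)

lemma list_rank_eqI:
  assumes "g ` A \<subseteq> carrier G" "fam_independent G x I" "x \<in> I \<rightarrow> generate G (g ` A)"
    and "g ` A \<subseteq> isolator G (x ` I)"
  shows "list_rank G g A = card I"
proof -
  define N where "N = generate G (g ` A)"
  have N: "subgroup N G" unfolding N_def using assms by (intro generate_is_subgroup)
  interpret S: comm_group "G\<lparr>carrier := N\<rparr>" by (rule subgroup_comm_group[OF N])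
  have xN: "x \<in> I \<rightarrow> N" "x ` I \<subseteq> N" "x ` I \<subseteq> carrier G"
    using assms by (auto simp: N_def fam_independent_def)
  have "N \<subseteq> isolator G (x ` I)" unfolding N_def using assms(4) xN by (intro generate_subset_isolator)
  then have "ab_rank (G\<lparr>carrier := N\<rparr>) = card I"
    using assms xN N by (intro S.ab_rank_eqI[of x]) (auto simp: fam_independent_subgroup isolator_subgroup)
  moreover have "carrier G \<inter> g ` A = g ` A" using assms(1) by blast
  ultimately show ?thesis by (simp add: list_rank_def subgroup_generated_def N_def)
qed

lemma ex_list_rank_family:
  assumes "finite A" "g \<in> A \<rightarrow> carrier G"
  obtains I :: "'a set" and x where "fam_independent G x I" "x \<in> I \<rightarrow> generate G (g ` A)"
    "generate G (g ` A) \<subseteq> isolator G (x ` I)"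
proof -
  define N where "N = generate G (g ` A)"
  have gA: "g ` A \<subseteq> carrier G" "g ` A \<subseteq> N" using assms by (auto simp: N_def intro: generate.incl)
  then have N: "subgroup N G" unfolding N_def by (intro generate_is_subgroup)
  interpret S: comm_group "G\<lparr>carrier := N\<rparr>" by (rule subgroup_comm_group[OF N])
  have "fin_generated (G\<lparr>carrier := N\<rparr>)"
    using assms gA generate_consistent[OF gA(2) N] by (auto simp: fin_generated_def N_def intro!: exI[of _ "g ` A"])
  then obtain I :: "'a set" and x where x: "fam_independent (G\<lparr>carrier := N\<rparr>) x I"
    "carrier (G\<lparr>carrier := N\<rparr>) \<subseteq> isolator (G\<lparr>carrier := N\<rparr>) (x ` I)"
    by (rule S.ex_rank_family)
  then have xN: "x \<in> I \<rightarrow> N" by (auto simp: fam_independent_def)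
  then have "fam_independent G x I" "N \<subseteq> isolator G (x ` I)"
    using x N isolator_subgroup[OF N, of "x ` I"] by (auto simp: fam_independent_subgroup)
  then show ?thesis using that xN by (simp add: N_def)
qed

text \<open>Lifting a rank family of the quotient and joining it to one of \<open>N\<close> gives a
  rank family of \<open>G\<close>.\<close>

lemma ab_rank_FactGroup:
  assumes N: "subgroup N G"
    and x: "fam_independent G x I" "x \<in> I \<rightarrow> N" "N \<subseteq> isolator G (x ` I)"
    and y: "fam_independent (G Mod N) y J" "carrier (G Mod N) \<subseteq> isolator (G Mod N) (y ` J)"
  shows "ab_rank G = card I + card J"
proof -
  interpret Q: comm_group "G Mod N" by (rule abelian_FactGroup[OF N])
  interpret nm: normal N G by (rule subgroup_imp_normal[OF N])
  have hom: "(\<lambda>u. N #> u) \<in> hom G (G Mod N)" by (rule nm.r_coset_hom_Mod)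
  have fin: "finite I" "finite J" and xc: "x \<in> I \<rightarrow> carrier G" and yc: "y \<in> J \<rightarrow> carrier (G Mod N)"
    using x y by (auto simp: fam_independent_def)
  have "\<exists>u\<in>carrier G. y j = N #> u" if "j \<in> J" for j
    using yc that by (auto simp: carrier_FactGroup Pi_iff)
  then obtain r where r: "r \<in> J \<rightarrow> carrier G" "\<And>j. j \<in> J \<Longrightarrow> y j = N #> r j" by (metis Pi_I')
  have proj: "N #> int_comb G r J c = int_comb (G Mod N) y J c" for c
  proof -
    have "N #> int_comb G r J c = int_comb (G Mod N) (\<lambda>j. N #> r j) J c"
      using int_comb_hom[OF comm_group_axioms Q.comm_group_axioms hom fin(2) r(1)] .
    also have "\<dots> = int_comb (G Mod N) y J c"
      by (rule Q.int_comb_cong) (use r hom in \<open>auto simp: carrier_FactGroup\<close>)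
    finally show ?thesis .
  qed
  have x_comb: "int_comb G x I c \<in> N" for c
    using x(2) fin generate_subgroup_incl[of "x ` I" N] N xc by (auto simp: generate_eq_int_comb)
  \<comment> \<open>Projection to the quotient removes the part over \<open>x\<close> and forces the
    coefficients on \<open>J\<close> to vanish; independence of \<open>x\<close> then deals with
    those on \<open>I\<close>.\<close>
  have indep: "fam_independent G (case_sum x r) (I <+> J)"
    unfolding fam_independent_def
  proof (intro conjI allI impI)
    fix c assume "int_comb G (case_sum x r) (I <+> J) c = \<one>"
    then have c: "int_comb G x I (c \<circ> Inl) \<otimes> int_comb G r J (c \<circ> Inr) = \<one>"
      using fin xc r by (simp add: int_comb_Plus)
    then have "int_comb G r J (c \<circ> Inr) = inv (int_comb G x I (c \<circ> Inl))"
      using xc r by (metis inv_equality int_comb_closed m_comm)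
    then have "int_comb G r J (c \<circ> Inr) \<in> N" using x_comb by (simp add: nm.m_inv_closed)
    then have "int_comb (G Mod N) y J (c \<circ> Inr) = \<one>\<^bsub>G Mod N\<^esub>"
      using r by (simp flip: proj add: coset_join2 N)
    then have J: "\<forall>j\<in>J. (c \<circ> Inr) j = 0" using y(1) unfolding fam_independent_def by blast
    then have "int_comb G r J (c \<circ> Inr) = \<one>" by (intro int_comb_zero) auto
    then have "int_comb G x I (c \<circ> Inl) = \<one>" using c xc by simp
    then have "\<forall>i\<in>I. (c \<circ> Inl) i = 0" using x(1) unfolding fam_independent_def by blast
    with J show "\<forall>k\<in>I <+> J. c k = 0" by auto
  qed (use fin xc r in auto)
  \<comment> \<open>Some power of \<open>u\<close> is a combination of the lifts up to a factor
    \<open>w\<close> in \<open>N\<close>, and a further power brings \<open>w\<close> into the span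
    of \<open>x\<close>; the exponents multiply.\<close>
  have "carrier G \<subseteq> isolator G (case_sum x r ` (I <+> J))"
  proof
    fix u assume u: "u \<in> carrier G"
    then have "N #> u \<in> isolator (G Mod N) (y ` J)" using y(2) by (auto simp: carrier_FactGroup)
    then obtain n :: int where n: "n \<noteq> 0" "(N #> u) [^]\<^bsub>G Mod N\<^esub> n \<in> generate (G Mod N) (y ` J)"
      by (auto simp: isolator_def)
    then obtain a where a: "(N #> u) [^]\<^bsub>G Mod N\<^esub> n = int_comb (G Mod N) y J a"
      using Q.generate_eq_int_comb[OF fin(2) yc] by auto
    define v where "v = int_comb G r J a"
    have v: "v \<in> carrier G" using r by (simp add: v_def)
    have "N #> u [^] n = N #> v" using a u by (simp add: nm.FactGroup_int_pow proj v_def)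
    then have "u [^] n \<in> N #> v" using repr_independenceD[OF N, of "u [^] n" v] u by simp
    then obtain w where w: "w \<in> N" "u [^] n = w \<otimes> v" by (auto simp: r_coset_def)
    then have wc: "w \<in> carrier G" using nm.subset by auto
    from w x(3) obtain m :: int where m: "m \<noteq> 0" "w [^] m \<in> generate G (x ` I)"
      by (auto simp: isolator_def)
    then obtain b where b: "w [^] m = int_comb G x I b" using fin xc by (auto simp: generate_eq_int_comb)
    have "u [^] (n * m) = (w \<otimes> v) [^] m" using u w by (simp flip: int_pow_pow)
    also have "\<dots> = int_comb G x I b \<otimes> int_comb G r J (\<lambda>j. a j * m)"
      using wc v b fin r by (simp add: int_pow_distrib int_comb_scale v_def)
    also have "\<dots> = int_comb G (case_sum x r) (I <+> J) (case_sum b (\<lambda>j. a j * m))"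
      using fin xc r by (simp add: int_comb_Plus comp_def)
    also have "\<dots> \<in> generate G (case_sum x r ` (I <+> J))"
      using indep by (subst generate_eq_int_comb) (auto simp: fam_independent_def)
    finally show "u \<in> isolator G (case_sum x r ` (I <+> J))"
      using u n m unfolding isolator_def by (auto intro!: exI[of _ "n * m"])
  qed
  from ab_rank_eqI[OF indep this] show ?thesis using fin by (simp add: card_Plus)
qed

lemma fin_generated_FactGroup:
  assumes "fin_generated G" "subgroup N G"
  shows "fin_generated (G Mod N)"
proof -
  interpret Q: comm_group "G Mod N" by (rule abelian_FactGroup[OF assms(2)])
  interpret nm: normal N G by (rule subgroup_imp_normal[OF assms(2)])
  obtain S where S: "finite S" "S \<subseteq> carrier G" "generate G S = carrier G"
    using assms(1) by (auto simp: fin_generated_def)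
  have "carrier (G Mod N) = generate (G Mod N) ((\<lambda>u. N #> u) ` S)"
  proof -
    have "group_hom G (G Mod N) (\<lambda>u. N #> u)"
      using nm.r_coset_hom_Mod by unfold_locales
    from group_hom.generate_img[OF this S(2)] show ?thesis using S by (simp add: carrier_FactGroup)
  qed
  then show ?thesis using S unfolding fin_generated_def
    by (intro exI[of _ "(\<lambda>u. N #> u) ` S"]) (auto simp: carrier_FactGroup)
qed

text \<open>Turns the exponent on the Tutte side, the difference of two ranks, into the rank of the
  quotient whose homomorphisms are counted.\<close>

lemma ab_rank_eq_list_rank_plus:
  assumes "fin_generated G" "finite A" "g \<in> A \<rightarrow> carrier G"
  shows "ab_rank G = list_rank G g A + ab_rank (G Mod generate G (g ` A))"
proof -
  define N where "N = generate G (g ` A)"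
  have gA: "g ` A \<subseteq> carrier G" using assms by auto
  then have N: "subgroup N G" unfolding N_def by (rule generate_is_subgroup)
  interpret Q: comm_group "G Mod N" by (rule abelian_FactGroup[OF N])
  obtain I :: "'a set" and x where x: "fam_independent G x I" "x \<in> I \<rightarrow> N" "N \<subseteq> isolator G (x ` I)"
    unfolding N_def using ex_list_rank_family[OF assms(2,3)] .
  obtain J :: "'a set set" and y where y: "fam_independent (G Mod N) y J"
      "carrier (G Mod N) \<subseteq> isolator (G Mod N) (y ` J)"
    using Q.ex_rank_family fin_generated_FactGroup[OF assms(1) N] by blast
  have "g ` A \<subseteq> N" unfolding N_def by (auto intro: generate.incl)
  then have "list_rank G g A = card I"
    using x gA by (intro list_rank_eqI) (auto simp: N_def)
  moreover have "ab_rank (G Mod N) = card J" using y by (rule Q.ab_rank_eqI)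
  ultimately show ?thesis using ab_rank_FactGroup[OF N x y] by (simp add: N_def)
qed

text \<open>The relation is solved for the term of \<open>e\<close>, whose exponent
  \<open>c e\<close> is nonzero.\<close>

lemma relation_imp_isolator:
  assumes "finite B" "e \<notin> B" "g \<in> insert e B \<rightarrow> carrier G"
    and "int_comb G g (insert e B) c = \<one>" "c e \<noteq> 0"
  shows "g e \<in> isolator G (g ` B)"
proof -
  have ge: "g e \<in> carrier G" and gB: "g \<in> B \<rightarrow> carrier G" using assms by auto
  have "g e [^] c e \<otimes> int_comb G g B c = \<one>" using assms by (simp add: int_comb_insert)
  then have "g e [^] c e = inv (int_comb G g B c)" using ge gB by (metis inv_equality int_comb_closed int_pow_closed)
  also have "\<dots> = int_comb G g B (\<lambda>i. - c i)" using assms gB by (simp add: int_comb_uminus)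
  also have "\<dots> \<in> generate G (g ` B)" using assms gB by (simp add: generate_eq_int_comb)
  finally show ?thesis using ge assms(5) by (auto simp: isolator_def)
qed

text \<open>In a dependent family some \<open>g e\<close> lies in the isolator of the others, so
  exchange makes the rank smaller than \<open>card A\<close>. This lets matroid independence be
  handled as absence of integer relations.\<close>

lemma list_rank_eq_card_iff:
  assumes "finite A" "g \<in> A \<rightarrow> carrier G"
  shows "list_rank G g A = card A \<longleftrightarrow> fam_independent G g A"
proof
  have gA: "g ` A \<subseteq> carrier G" using assms by auto
  show "list_rank G g A = card A" if "fam_independent G g A"
    using that gA generate_le_isolator[OF gA]
    by (intro list_rank_eqI) (auto intro: generate.incl)
  assume rank: "list_rank G g A = card A"
  show "fam_independent G g A"
  proof (rule ccontr)
    assume "\<not> fam_independent G g A"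
    then obtain c e where c: "int_comb G g A c = \<one>" "e \<in> A" "c e \<noteq> 0"
      using assms by (auto simp: fam_independent_def)
    define B where "B = A - {e}"
    have B: "A = insert e B" "e \<notin> B" "finite B" using c assms by (auto simp: B_def)
    have gB: "g \<in> B \<rightarrow> carrier G" "g ` B \<subseteq> carrier G" using assms B by auto
    have "g e \<in> isolator G (g ` B)"
      using relation_imp_isolator[of B e g c] B c assms by simp
    moreover have "g ` B \<subseteq> isolator G (g ` B)"
      using generate_le_isolator[OF gB(2)] by (auto intro: generate.incl)
    ultimately have "generate G (g ` A) \<subseteq> isolator G (g ` B)"
      using gB B by (intro generate_subset_isolator) auto
    moreover obtain I :: "'a set" and x where x: "fam_independent G x I" "x \<in> I \<rightarrow> generate G (g ` A)"
        "generate G (g ` A) \<subseteq> isolator G (x ` I)"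
      using ex_list_rank_family[OF assms] .
    ultimately have "card I \<le> card B"
      using B gB by (intro exchange_card_le[of x I B g]) auto
    moreover have "list_rank G g A = card I"
      using x gA by (intro list_rank_eqI) (auto intro: generate.incl)
    ultimately show False using rank B by simp
  qed
qed

end

section \<open>From bases to arbitrary subsets\<close>

context comm_group
begin

text \<open>Moves the condition from the quotient to a closure property of \<open>N\<close> inside
  \<open>G\<close>, where different subgroups can be compared.\<close>

lemma no_torsion_at_FactGroup_iff:
  assumes "subgroup N G"
  shows "no_torsion_at (G Mod N) p \<longleftrightarrow> (\<forall>u\<in>carrier G. u [^] p \<in> N \<longrightarrow> u \<in> N)"
proof -
  interpret nm: normal N G by (rule subgroup_imp_normal[OF assms])
  have "N #> u = N \<longleftrightarrow> u \<in> N" if "u \<in> carrier G" for u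
    using that assms coset_join1 coset_join2 by blast
  then show ?thesis
    by (auto simp: no_torsion_at_def carrier_FactGroup nm.FactGroup_pow)
qed

text \<open>Coordinates over an independent family are unique. Raising \<open>u\<close> to the power
  \<open>n\<close> multiplies them by \<open>n\<close>, so they vanish outside \<open>B'\<close> if
  those of the power do.\<close>

lemma fam_independent_root_mem:
  assumes B: "fam_independent G g B" and "B' \<subseteq> B" and "u \<in> generate G (g ` B)"
    and "n \<noteq> 0" "u [^] (n::int) \<in> generate G (g ` B')"
  shows "u \<in> generate G (g ` B')"
proof -
  have fin: "finite B" "finite B'" and g: "g \<in> B \<rightarrow> carrier G" "g \<in> B' \<rightarrow> carrier G"
    using assms finite_subset by (auto simp: fam_independent_def)
  obtain c where c: "u = int_comb G g B c" using assms(3) fin g by (auto simp: generate_eq_int_comb)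
  obtain b where b: "u [^] n = int_comb G g B' b" using assms(5) fin g by (auto simp: generate_eq_int_comb)
  \<comment> \<open>The coefficients \<open>b\<close> are cut off outside \<open>B'\<close> so that
    both sides can be compared over the same independent family \<open>B\<close>.\<close>
  have "int_comb G g B (\<lambda>i. c i * n) = int_comb G g B' (\<lambda>i. if i \<in> B' then b i else 0)"
    unfolding int_comb_scale[OF fin(1) g(1)] c[symmetric] b by (rule int_comb_cong) (use g in auto)
  also have "\<dots> = int_comb G g B (\<lambda>i. if i \<in> B' then b i else 0)"
    by (rule int_comb_subset[symmetric]) (use fin g assms(2) in auto)
  finally have "int_comb G g B (\<lambda>i. c i * n - (if i \<in> B' then b i else 0)) = \<one>"
    using fin g by (simp add: int_comb_diff_eq_one_iff)
  then have "\<forall>i\<in>B. c i * n - (if i \<in> B' then b i else 0) = 0"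
    using B unfolding fam_independent_def by blast
  then have "c i = 0" if "i \<in> B - B'" for i using that assms(4) by auto
  then have "u = int_comb G g B' c" unfolding c by (intro int_comb_subset fin g assms(2))
  then show ?thesis using fin g by (simp add: generate_eq_int_comb)
qed

text \<open>\<open>B'\<close> has the same isolator as \<open>A\<close>, while the larger family
  \<open>B\<close> is the one modulo which torsion is known to be absent.\<close>

lemma no_torsion_at_transfer:
  assumes p: "Factorial_Ring.prime p" and B: "fam_independent G g B" and "B' \<subseteq> B" "B' \<subseteq> A"
    and gA: "g ` A \<subseteq> carrier G" "g ` A \<subseteq> isolator G (g ` B')"
    and pure: "no_torsion_at (G Mod generate G (g ` B)) p"
  shows "no_torsion_at (G Mod generate G (g ` A)) p"
proof -
  have gB: "g ` B \<subseteq> carrier G" "g ` B' \<subseteq> carrier G"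
    using B assms(3) by (auto simp: fam_independent_def)
  note sub = generate_is_subgroup[OF gA(1)] generate_is_subgroup[OF gB(1)] generate_is_subgroup[OF gB(2)]
  have pure1: "u \<in> generate G (g ` B)" if "u \<in> carrier G" "u [^] p \<in> generate G (g ` B)" for u
    using pure that by (simp add: no_torsion_at_FactGroup_iff[OF sub(2)])
  \<comment> \<open>Iterates \<open>pure1\<close>, since the exponent to be removed later is a power
    of \<open>p\<close>.\<close>
  have pure: "u \<in> generate G (g ` B)" if "u \<in> carrier G" "u [^] (p ^ j) \<in> generate G (g ` B)" for u j
    using that
  proof (induction j arbitrary: u)
    case (Suc j)
    then have "(u [^] p) [^] (p ^ j) \<in> generate G (g ` B)" by (simp add: nat_pow_pow)
    then have "u [^] p \<in> generate G (g ` B)" by (rule Suc.IH[rotated]) (use Suc.prems in simp)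
    then show ?case by (rule pure1[OF Suc.prems(1)])
  qed simp
  show ?thesis
    unfolding no_torsion_at_FactGroup_iff[OF sub(1)]
  proof (intro ballI impI)
    fix u assume u: "u \<in> carrier G" "u [^] p \<in> generate G (g ` A)"
    have "u [^] p \<in> isolator G (g ` B')"
      using u(2) generate_subset_isolator[OF gB(2) gA(2)] by blast
    then obtain k where k: "k \<noteq> 0" "(u [^] p) [^] (k::int) \<in> generate G (g ` B')"
      by (auto simp: isolator_def)
    have "\<not> is_unit (int p)" using prime_gt_1_nat[OF p] by simp
    \<comment> \<open>The \<open>p\<close>-part of \<open>k\<close> joins the factor
      \<open>p\<close> already present, hence \<open>Suc j\<close> below; the cofactor
      \<open>k'\<close> is absorbed into the new element \<open>y\<close>.\<close>
    then obtain k' where k': "k = int p ^ multiplicity (int p) k * k'" "\<not> int p dvd k'"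
      using multiplicity_decompose'[OF k(1)] by blast
    define j where "j = multiplicity (int p) k"
    define y where "y = u [^] k'"
    have y: "y \<in> carrier G" using u by (simp add: y_def)
    have "(u [^] p) [^] k = y [^] (p ^ Suc j)"
    proof -
      have "(u [^] p) [^] k = u [^] (int p * k)" using u by (simp add: int_pow_pow flip: int_pow_int)
      also have "int p * k = k' * int (p ^ Suc j)" using k'(1) by (simp add: j_def mult_ac)
      also have "u [^] \<dots> = y [^] int (p ^ Suc j)" unfolding y_def using u by (simp add: int_pow_pow)
      finally show ?thesis by (simp only: int_pow_int)
    qed
    then have y_pow: "y [^] (p ^ Suc j) \<in> generate G (g ` B')" using k by simp
    then have "y \<in> generate G (g ` B)"
      using pure[OF y, of "Suc j"] mono_generate[of "g ` B'" "g ` B"] assms(3) by blast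
    moreover have "y [^] int (p ^ Suc j) \<in> generate G (g ` B')"
      using y_pow by (simp only: int_pow_int)
    moreover have "int (p ^ Suc j) \<noteq> 0" using p by auto
    ultimately have "y \<in> generate G (g ` B')"
      using fam_independent_root_mem[OF B assms(3)] by blast
    then have yA: "u [^] k' \<in> generate G (g ` A)"
      unfolding y_def using mono_generate[of "g ` B'" "g ` A"] assms(4) by blast
    have "coprime (int p) k'" using p k'(2) by (simp add: prime_imp_coprime)
    \<comment> \<open>Bezout's identity recovers \<open>u\<close> from its powers with exponents
      \<open>p\<close> and \<open>k'\<close>, both of which lie in the subgroup generated by
      \<open>A\<close>.\<close>
    then obtain a b where ab: "a * int p + b * k' = 1"
      using bezout_int[of "int p" k'] by auto
    have "u = u [^] (int p * a + k' * b)" using ab u by (simp add: mult.commute)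
    also have "\<dots> = (u [^] int p) [^] a \<otimes> (u [^] k') [^] b"
      using u by (simp add: int_pow_mult int_pow_pow)
    also have "\<dots> \<in> generate G (g ` A)"
      using subgroup_int_pow_closed[OF sub(1) u(2), of a] subgroup_int_pow_closed[OF sub(1) yA, of b]
      by (simp add: int_pow_int generate.eng)
    finally show "u \<in> generate G (g ` A)" .
  qed
qed

lemma mem_matroid_indep_iff:
  assumes "finite E" "g \<in> E \<rightarrow> carrier G"
  shows "B \<in> matroid_indep E (list_rank G g) \<longleftrightarrow> B \<subseteq> E \<and> fam_independent G g B"
proof (cases "B \<subseteq> E")
  case True
  then have "finite B" "g \<in> B \<rightarrow> carrier G" using assms finite_subset by auto
  then show ?thesis using True by (simp add: matroid_indep_def list_rank_eq_card_iff)
qed (simp add: matroid_indep_def)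

text \<open>Maximality of \<open>B'\<close> within \<open>A\<close> puts all of \<open>A\<close>
  into its isolator; maximality of \<open>B\<close> above \<open>B'\<close> makes \<open>B\<close> a
  basis.\<close>

lemma no_torsion_at_all_subsets:
  assumes E: "finite E" "g \<in> E \<rightarrow> carrier G" and p: "Factorial_Ring.prime p" and "A \<subseteq> E"
    and bases: "\<And>B. B \<in> matroid_bases E (list_rank G g) \<Longrightarrow> no_torsion_at (G Mod generate G (g ` B)) p"
  shows "no_torsion_at (G Mod generate G (g ` A)) p"
proof -
  let ?I = "matroid_indep E (list_rank G g)"
  note indep = mem_matroid_indep_iff[OF E]
  have fin: "finite ?I" using E by (auto simp: matroid_indep_def)
  have "{} \<in> ?I" by (simp add: indep fam_independent_def)
  then obtain B' where B': "B' \<in> ?I" "B' \<subseteq> A" "\<And>C. C \<in> ?I \<Longrightarrow> C \<subseteq> A \<Longrightarrow> B' \<subseteq> C \<Longrightarrow> B' = C"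
    using finite_has_maximal2[of "{C \<in> ?I. C \<subseteq> A}" "{}"] fin by auto
  obtain B where B: "B \<in> ?I" "B' \<subseteq> B" "\<And>C. C \<in> ?I \<Longrightarrow> B \<subseteq> C \<Longrightarrow> B = C"
    using finite_has_maximal2[OF fin B'(1)] by auto
  have B'_indep: "fam_independent G g B'" "B' \<subseteq> E" using B' by (auto simp: indep)
  have gA: "g ` A \<subseteq> carrier G" "g ` B' \<subseteq> carrier G" "finite B'"
    using E assms(4) B'_indep finite_subset by auto
  have "g e \<in> isolator G (g ` B')" if e: "e \<in> A" for e
  proof (cases "e \<in> B'")
    case True
    then show ?thesis using generate_le_isolator[OF gA(2)] by (auto intro: generate.incl)
  next
    case False
    have gi: "g \<in> insert e B' \<rightarrow> carrier G" using e gA by auto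
    have "insert e B' \<notin> ?I" using B'(3)[of "insert e B'"] B'(2) e False by auto
    then have "\<not> fam_independent G g (insert e B')" using e assms(4) B'_indep by (auto simp: indep)
    then obtain c where c: "int_comb G g (insert e B') c = \<one>" "\<exists>i\<in>insert e B'. c i \<noteq> 0"
      using gi gA(3) by (auto simp: fam_independent_def)
    \<comment> \<open>Otherwise the relation would be a nontrivial one of the independent family
      \<open>B'\<close>.\<close>
    have "c e \<noteq> 0"
    proof
      assume "c e = 0"
      then have "int_comb G g B' c = \<one>" using c(1) gi gA(3) False by (simp add: int_comb_insert)
      then have "\<forall>i\<in>B'. c i = 0" using B'_indep unfolding fam_independent_def by blast
      with c(2) \<open>c e = 0\<close> show False by blast
    qed
    then show ?thesis using relation_imp_isolator[OF gA(3) False gi c(1)] by blast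
  qed
  then have "g ` A \<subseteq> isolator G (g ` B')" by blast
  moreover have "B \<in> matroid_bases E (list_rank G g)"
    using B by (auto simp: matroid_bases_def)
  ultimately show ?thesis
    using no_torsion_at_transfer[OF p _ B(2) B'(2) gA(1)] bases B(1) by (auto simp: indep)
qed

text \<open>The condition passes from bases to all subsets separately for each prime divisor of
  \<open>q\<close>.\<close>

lemma Z_M_iff:
  assumes "fin_generated G" "finite E" "g \<in> E \<rightarrow> carrier G" "q > 0"
  shows "q \<in> Z_M G E g \<longleftrightarrow> (\<forall>A\<subseteq>E. coprime q (multiplicity_fun G g A))"
proof -
  let ?B = "matroid_bases E (list_rank G g)"
  have B: "B \<subseteq> E" if "B \<in> ?B" for B using that by (auto simp: matroid_bases_def matroid_indep_def)
  then have fin: "finite ?B" using assms(2) by (meson PowI finite_Pow_iff finite_subset subsetI)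
  have mult: "coprime q (multiplicity_fun G g A) \<longleftrightarrow>
      (\<forall>p. Factorial_Ring.prime p \<longrightarrow> p dvd q \<longrightarrow> no_torsion_at (G Mod generate G (g ` A)) p)"
    if A: "A \<subseteq> E" for A
  proof -
    have N: "subgroup (generate G (g ` A)) G" using A assms(3) by (intro generate_is_subgroup) auto
    interpret Q: comm_group "G Mod generate G (g ` A)" by (rule abelian_FactGroup[OF N])
    obtain I :: "'a set set" and x d where "cyclic_generators (G Mod generate G (g ` A)) I x d"
      using Q.fin_generated_cyclic_generators[OF fin_generated_FactGroup[OF assms(1) N]] .
    then have "finite (torsion_part (G Mod generate G (g ` A)))"
      by (rule cyclic_generators.finite_torsion_part)
    then show ?thesis
      unfolding multiplicity_fun_def using assms(4) by (rule Q.coprime_card_torsion_part_iff)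
  qed
  have "q \<in> Z_M G E g \<longleftrightarrow> coprime q (Lcm (multiplicity_fun G g ` ?B))"
    using assms(4) by (simp add: Z_M_def coprime_iff_gcd_eq_1)
  also have "\<dots> \<longleftrightarrow> (\<forall>B\<in>?B. coprime q (multiplicity_fun G g B))"
  proof
    assume *: "coprime q (Lcm (multiplicity_fun G g ` ?B))"
    show "\<forall>B\<in>?B. coprime q (multiplicity_fun G g B)"
    proof
      fix B assume "B \<in> ?B"
      then have "multiplicity_fun G g B dvd Lcm (multiplicity_fun G g ` ?B)" by (intro dvd_Lcm) simp
      then show "coprime q (multiplicity_fun G g B)" using * coprime_divisors dvd_refl by blast
    qed
  next
    assume "\<forall>B\<in>?B. coprime q (multiplicity_fun G g B)"
    then have "coprime q (\<Prod>B\<in>?B. multiplicity_fun G g B)" by (intro prod_coprime_right) auto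
    \<comment> \<open>The product is a common multiple, hence divisible by the least one, and
      coprimality passes to divisors.\<close>
    moreover have "Lcm (multiplicity_fun G g ` ?B) dvd (\<Prod>B\<in>?B. multiplicity_fun G g B)"
      using fin by (intro Lcm_least) (auto intro: dvd_prodI)
    ultimately show "coprime q (Lcm (multiplicity_fun G g ` ?B))"
      using coprime_divisors dvd_refl by blast
  qed
  also have "\<dots> \<longleftrightarrow> (\<forall>A\<subseteq>E. coprime q (multiplicity_fun G g A))"
  proof (intro iffI allI impI)
    fix A assume *: "\<forall>B\<in>?B. coprime q (multiplicity_fun G g B)" and A: "A \<subseteq> E"
    show "coprime q (multiplicity_fun G g A)"
      unfolding mult[OF A]
    proof (intro allI impI)
      fix p assume p: "Factorial_Ring.prime p" "p dvd q"
      show "no_torsion_at (G Mod generate G (g ` A)) p"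
      proof (rule no_torsion_at_all_subsets[OF assms(2,3) p(1) A])
        fix C assume "C \<in> ?B"
        then show "no_torsion_at (G Mod generate G (g ` C)) p"
          using * p mult[OF B] by blast
      qed
    qed
  qed (use B in blast)
  finally show ?thesis .
qed

text \<open>A homomorphism trivial on all \<open>g e\<close> with \<open>e\<close> in
  \<open>A\<close> has the subgroup they generate in its kernel, so it factors uniquely through the
  quotient.\<close>

lemma bij_betw_Hom_set_FactGroup:
  assumes "comm_group H" "g ` A \<subseteq> carrier G"
  shows "bij_betw (\<lambda>\<psi>. \<lambda>u\<in>carrier G. \<psi> (generate G (g ` A) #> u)) (Hom_set (G Mod generate G (g ` A)) H)
    {\<phi> \<in> Hom_set G H. \<forall>e\<in>A. \<phi> (g e) = \<one>\<^bsub>H\<^esub>}"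
  unfolding bij_betw_def
proof
  interpret H: comm_group H by fact
  define N where "N = generate G (g ` A)"
  have N: "subgroup N G" unfolding N_def using assms(2) by (rule generate_is_subgroup)
  have gN: "g e \<in> N" if "e \<in> A" for e using that by (auto simp: N_def intro: generate.incl)
  interpret nm: normal N G by (rule subgroup_imp_normal[OF N])
  interpret Q: comm_group "G Mod N" by (rule abelian_FactGroup[OF N])
  let ?F = "\<lambda>\<psi>. \<lambda>u\<in>carrier G. \<psi> (N #> u)"
  show "inj_on (\<lambda>\<psi>. \<lambda>u\<in>carrier G. \<psi> (generate G (g ` A) #> u)) (Hom_set (G Mod generate G (g ` A)) H)"
    unfolding N_def[symmetric]
  proof (rule inj_onI)
    fix \<psi> \<psi>' assume *: "\<psi> \<in> Hom_set (G Mod N) H" "\<psi>' \<in> Hom_set (G Mod N) H" "?F \<psi> = ?F \<psi>'"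
    show "\<psi> = \<psi>'"
    proof (rule extensionalityI)
      show "\<psi> \<in> extensional (carrier (G Mod N))" "\<psi>' \<in> extensional (carrier (G Mod N))"
        using * by (auto simp: Hom_set_def)
      fix U assume "U \<in> carrier (G Mod N)"
      then obtain u where "u \<in> carrier G" "U = N #> u" by (auto simp: carrier_FactGroup)
      then show "\<psi> U = \<psi>' U" using fun_cong[OF *(3), of u] by simp
    qed
  qed
  show "(\<lambda>\<psi>. \<lambda>u\<in>carrier G. \<psi> (generate G (g ` A) #> u)) ` Hom_set (G Mod generate G (g ` A)) H =
      {\<phi> \<in> Hom_set G H. \<forall>e\<in>A. \<phi> (g e) = \<one>\<^bsub>H\<^esub>}"
    unfolding N_def[symmetric]
  proof (intro subset_antisym subsetI)
    fix \<phi> assume "\<phi> \<in> ?F ` Hom_set (G Mod N) H"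
    then obtain \<psi> where \<psi>: "\<psi> \<in> hom (G Mod N) H" "\<phi> = ?F \<psi>" by (auto simp: Hom_set_def)
    have "?F \<psi> \<in> hom G H"
      using hom_compose[OF nm.r_coset_hom_Mod \<psi>(1)] by (simp add: compose_def)
    moreover have "?F \<psi> (g e) = \<one>\<^bsub>H\<^esub>" if "e \<in> A" for e
      using that assms(2) gN[OF that] coset_join2[OF _ N gN[OF that]] hom_one[OF \<psi>(1) Q.is_group H.is_group]
      by auto
    ultimately show "\<phi> \<in> {\<phi> \<in> Hom_set G H. \<forall>e\<in>A. \<phi> (g e) = \<one>\<^bsub>H\<^esub>}"
      using \<psi> by (auto simp: Hom_set_def)
  next
    fix \<phi> assume "\<phi> \<in> {\<phi> \<in> Hom_set G H. \<forall>e\<in>A. \<phi> (g e) = \<one>\<^bsub>H\<^esub>}"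
    then have \<phi>: "\<phi> \<in> hom G H" "\<phi> \<in> extensional (carrier G)" "\<And>e. e \<in> A \<Longrightarrow> \<phi> (g e) = \<one>\<^bsub>H\<^esub>"
      by (auto simp: Hom_set_def)
    interpret h: group_hom G H \<phi> using \<phi>(1) by unfold_locales
    have "N \<subseteq> kernel G H \<phi>" unfolding N_def
      using \<phi>(3) assms(2) by (intro generate_subgroup_incl h.subgroup_kernel) (auto simp: kernel_def)
    then obtain \<psi> where \<psi>: "\<psi> \<in> hom (G Mod N) H" "\<And>u. u \<in> carrier G \<Longrightarrow> \<psi> (N #> u) = \<phi> u"
      using h.FactGroup_universal_kernel[OF nm.normal_axioms] by blast
    \<comment> \<open>Restriction gives the factor map the extensional form that
      \<open>Hom_set\<close> requires.\<close>
    define \<psi>' where "\<psi>' = restrict \<psi> (carrier (G Mod N))"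
    have "\<psi>' \<in> Hom_set (G Mod N) H"
      using \<psi>(1) Q.m_closed by (auto simp: \<psi>'_def Hom_set_def hom_def Pi_iff)
    moreover have "\<phi> = ?F \<psi>'"
      by (rule extensionalityI[of _ "carrier G"])
        (use \<phi> \<psi> in \<open>auto simp: \<psi>'_def carrier_FactGroup\<close>)
    ultimately show "\<phi> \<in> ?F ` Hom_set (G Mod N) H" by blast
  qed
qed

end

section \<open>Comparison of coefficients\<close>

text \<open>The exponent function of the squarefree monomial attached to \<open>A\<close>.\<close>

definition vmono :: "'e set \<Rightarrow> 'e \<Rightarrow>\<^sub>0 nat" where
  "vmono A = (\<Sum>e\<in>A. Poly_Mapping.single e 1)"

lemma lookup_vmono: "finite A \<Longrightarrow> Poly_Mapping.lookup (vmono A) e = (if e \<in> A then 1 else 0)"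
  by (simp add: vmono_def lookup_sum lookup_single when_def)

lemma vmono_inject: "finite A \<Longrightarrow> finite B \<Longrightarrow> vmono A = vmono B \<longleftrightarrow> A = B"
  by (metis lookup_vmono one_neq_zero subset_antisym subsetI)

lemma prod_pvar: "finite A \<Longrightarrow> (\<Prod>e\<in>A. pvar e) = Poly_Mapping.single (vmono A) 1"
  by (induction A rule: finite_induct) (auto simp: vmono_def pvar_def mult_single simp flip: single_one)

lemma sum_single: "(\<Sum>i\<in>S. Poly_Mapping.single m (f i)) = Poly_Mapping.single m (\<Sum>i\<in>S. f i)"
  by (induction S rule: infinite_finite_induct) (auto simp: single_add)

text \<open>Distinct subsets have distinct monomials, so each coefficient can be read off at its own
  \<open>vmono\<close>.\<close>

lemma sum_vmono_eq_iff:
  assumes "finite E"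
  shows "(\<Sum>A\<in>Pow E. Poly_Mapping.single (vmono A) (f A)) = (\<Sum>A\<in>Pow E. Poly_Mapping.single (vmono A) (h A))
    \<longleftrightarrow> (\<forall>A\<subseteq>E. f A = h A)"
proof -
  have lookup: "Poly_Mapping.lookup (\<Sum>A\<in>Pow E. Poly_Mapping.single (vmono A) (f A)) (vmono B) = f B"
    if "B \<subseteq> E" for B and f :: "'a set \<Rightarrow> 'b"
  proof -
    have "Poly_Mapping.lookup (\<Sum>A\<in>Pow E. Poly_Mapping.single (vmono A) (f A)) (vmono B) =
        (\<Sum>A\<in>Pow E. if A = B then f A else 0)"
      unfolding lookup_sum using that assms
      by (intro sum.cong) (auto simp: lookup_single when_def vmono_inject finite_subset)
    then show ?thesis using that assms by simp
  qed
  show ?thesis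
  proof (intro iffI allI impI)
    fix A assume eq: "(\<Sum>A\<in>Pow E. Poly_Mapping.single (vmono A) (f A)) =
      (\<Sum>A\<in>Pow E. Poly_Mapping.single (vmono A) (h A))" and A: "A \<subseteq> E"
    show "f A = h A" using lookup[OF A, of f] lookup[OF A, of h] eq by simp
  qed (auto intro: sum.cong)
qed

text \<open>Each product is expanded over subsets, and the two sums are exchanged; the inner sum of
  indicators then counts homomorphisms.\<close>

lemma hom_partition_function_eq:
  fixes E :: "'e set"
  assumes "finite E" "finite (Hom_set G H)"
  shows "hom_partition_function G H E g =
    (\<Sum>A\<in>Pow E. Poly_Mapping.single (vmono A)
      (of_nat (card {\<phi> \<in> Hom_set G H. \<forall>e\<in>A. \<phi> (g e) = \<one>\<^bsub>H\<^esub>})))"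
proof -
  let ?\<delta> = "\<lambda>\<phi> A. if \<forall>e\<in>A. \<phi> (g e) = \<one>\<^bsub>H\<^esub> then 1 else 0 :: rat"
  have "(\<Prod>e\<in>E. 1 + pvar e * (if \<phi> (g e) = \<one>\<^bsub>H\<^esub> then 1 else 0)) =
      (\<Sum>A\<in>Pow E. Poly_Mapping.single (vmono A) (?\<delta> \<phi> A))" for \<phi>
  proof -
    have "(\<Prod>e\<in>E. 1 + pvar e * (if \<phi> (g e) = \<one>\<^bsub>H\<^esub> then 1 else 0)) =
        (\<Sum>A\<in>Pow E. \<Prod>e\<in>A. pvar e * (if \<phi> (g e) = \<one>\<^bsub>H\<^esub> then 1 else 0))"
      using prod_add[OF assms(1), of "\<lambda>e. pvar e * (if \<phi> (g e) = \<one>\<^bsub>H\<^esub> then 1 else 0)" "\<lambda>_. 1"]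
      by (simp add: add.commute)
    also have "\<dots> = (\<Sum>A\<in>Pow E. Poly_Mapping.single (vmono A) (?\<delta> \<phi> A))"
    proof (rule sum.cong)
      fix A assume "A \<in> Pow E"
      then have A: "finite A" using assms finite_subset by auto
      \<comment> \<open>A product of Kronecker deltas is the indicator that all conditions hold at
        once.\<close>
      then have "(\<Prod>e\<in>A. if \<phi> (g e) = \<one>\<^bsub>H\<^esub> then 1 else 0) = (if \<forall>e\<in>A. \<phi> (g e) = \<one>\<^bsub>H\<^esub> then 1 else 0 :: 'e mvpoly)"
        by (induction A rule: finite_induct) auto
      then show "(\<Prod>e\<in>A. pvar e * (if \<phi> (g e) = \<one>\<^bsub>H\<^esub> then 1 else 0)) = Poly_Mapping.single (vmono A) (?\<delta> \<phi> A)"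
        using A by (simp only: prod.distrib prod_pvar) auto
    qed simp
    finally show ?thesis .
  qed
  then have "hom_partition_function G H E g =
      (\<Sum>\<phi>\<in>Hom_set G H. \<Sum>A\<in>Pow E. Poly_Mapping.single (vmono A) (?\<delta> \<phi> A))"
    by (simp add: hom_partition_function_def)
  also have "\<dots> = (\<Sum>A\<in>Pow E. Poly_Mapping.single (vmono A) (\<Sum>\<phi>\<in>Hom_set G H. ?\<delta> \<phi> A))"
    by (subst sum.swap) (simp add: sum_single)
  moreover have "(\<Sum>\<phi>\<in>Hom_set G H. ?\<delta> \<phi> A) = of_nat (card {\<phi> \<in> Hom_set G H. \<forall>e\<in>A. \<phi> (g e) = \<one>\<^bsub>H\<^esub>})" for A
    using assms(2) by (simp flip: sum.inter_filter)
  ultimately show ?thesis by simp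
qed

lemma pconst_mult_multivariate_tutte:
  assumes "finite E"
  shows "pconst c * multivariate_tutte E r q =
    (\<Sum>A\<in>Pow E. Poly_Mapping.single (vmono A) (c * of_nat q powi (- int (r A))))"
  unfolding multivariate_tutte_def sum_distrib_left
proof (rule sum.cong)
  fix A assume "A \<in> Pow E"
  then have "finite A" using assms finite_subset by auto
  then show "pconst c * (pconst (of_nat q powi (- int (r A))) * (\<Prod>e\<in>A. pvar e)) =
      Poly_Mapping.single (vmono A) (c * of_nat q powi (- int (r A)))"
    by (simp add: prod_pvar pconst_def mult_single)
qed simp

theorem theorem7p6:
  fixes G :: "('a, 'b) monoid_scheme" and H :: "('c, 'd) monoid_scheme"
    and E :: "'e set" and g :: "'e \<Rightarrow> 'a" and q :: nat
  assumes "comm_group G" and "fin_generated G"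
    and "finite E" and "g \<in> E \<rightarrow> carrier G"
    and "comm_group H" and "finite (carrier H)" and "card (carrier H) = q"
  shows "q \<in> Z_M G E g \<longleftrightarrow>
    hom_partition_function G H E g =
      pconst (of_nat q ^ ab_rank G) * multivariate_tutte E (list_rank G g) q"
proof -
  interpret G: comm_group G by fact
  interpret H: comm_group H by fact
  have "carrier H \<noteq> {}" using H.one_closed by blast
  \<comment> \<open>Positivity belongs to membership in \<open>Z_M\<close> and allows negative
    powers of \<open>q\<close> to be cancelled.\<close>
  then have q: "q > 0" using assms(6,7) by (auto simp: card_gt_0_iff)
  let ?h = "\<lambda>A. card {\<phi> \<in> Hom_set G H. \<forall>e\<in>A. \<phi> (g e) = \<one>\<^bsub>H\<^esub>}"
  \<comment> \<open>Each comparison of coefficients is a counting statement about one quotient,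
    decided by the size of its torsion part.\<close>
  have "of_nat (?h A) = (of_nat q ^ ab_rank G * of_nat q powi (- int (list_rank G g A)) :: rat) \<longleftrightarrow>
      coprime q (multiplicity_fun G g A)" if A: "A \<subseteq> E" for A
  proof -
    let ?Q = "G Mod generate G (g ` A)"
    have gA: "finite A" "g \<in> A \<rightarrow> carrier G" "g ` A \<subseteq> carrier G" using A assms finite_subset by auto
    then have N: "subgroup (generate G (g ` A)) G" by (intro G.generate_is_subgroup)
    interpret Q: comm_group ?Q by (rule G.abelian_FactGroup[OF N])
    have "of_nat q ^ ab_rank G * of_nat q powi (- int (list_rank G g A)) = (of_nat (q ^ ab_rank ?Q) :: rat)"
      using q by (simp add: G.ab_rank_eq_list_rank_plus[OF assms(2) gA(1,2)] power_add power_int_minus)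
    moreover have "?h A = card (Hom_set ?Q H)"
      using bij_betw_same_card[OF G.bij_betw_Hom_set_FactGroup[OF assms(5) gA(3)]] by simp
    moreover have "card (Hom_set ?Q H) = q ^ ab_rank ?Q \<longleftrightarrow> coprime q (multiplicity_fun G g A)"
      using Q.card_Hom_set_eq_iff[OF G.fin_generated_FactGroup[OF assms(2) N] assms(5,6)] assms(7)
      by (simp add: multiplicity_fun_def order_def)
    ultimately show ?thesis by (simp only: of_nat_eq_iff)
  qed
  then show ?thesis
    unfolding hom_partition_function_eq[OF assms(3) G.fin_generated_finite_Hom_set[OF assms(2,5,6)]]
      pconst_mult_multivariate_tutte[OF assms(3)] sum_vmono_eq_iff[OF assms(3)]
      G.Z_M_iff[OF assms(2-4) q] by blast
qed

end
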